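(* Let $m=2$ and let $(\alpha_0^{(1)},\alpha_0^{(2)})\in\mathbb{Q}_p^2$. If $1,\alpha_0^{(1)},\alpha_0^{(2)}$ are linearly dependent over $\mathbb{Q}$ and the $p$-adic Jacobi--Perron algorithm does not stop on the input $(\alpha_0^{(1)},\alpha_0^{(2)})$, then $v_p(a_n^{(1)})=-1$ for infinitely many $n\in\mathbb{N}$.
   Context: Let $p$ be an odd prime and $v_p$ the $p$-adic valuation on $\mathbb{Q}_p$. Every $\alpha\in\mathbb{Q}_p$ can be written uniquely as $\alpha=\sum_{j=k}^{\infty}x_jp^j$ with $k\in\mathbb{Z}$ and $x_j\in\mathbb{Z}\cap(-\frac p2,\frac p2)$. The Browkin $s$-function is $s(\alpha)=\sum_{j=k}^{0}x_jp^j$ (the sum of the terms with $j\le 0$; it is $0$ if there are none). $p$-adic Jacobi--Perron algorithm of dimension $2$: on input $(\alpha_0^{(1)},\alpha_0^{(2)})\in\mathbb{Q}_p^2$, for $n=0,1,2,\ldots$ put $a_n^{(i)}=s(\alpha_n^{(i)})$ for $i=1,2$ (the partial quotients). If $\alpha_n^{(2)}=a_n^{(2)}$ the algorithm stops; otherwise set $\alpha_{n+1}^{(1)}=\dfrac{1}{\alpha_n^{(2)}-a_n^{(2)}}$ and $\alpha_{n+1}^{(2)}=\dfrac{\alpha_n^{(1)}-a_n^{(1)}}{\alpha_n^{(2)}-a_n^{(2)}}$, and continue. *)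

theory Defs
  imports Complex_Main "HOL-Computational_Algebra.Primes" Berlekamp_Zassenhaus.Finite_Field
begin

section \<open>The p-adic absolute value on the rationals\<close>

definition rat_padic_val :: "nat \<Rightarrow> rat \<Rightarrow> int" where
  "rat_padic_val p q =
     int (multiplicity (int p) (fst (quotient_of q))) -
     int (multiplicity (int p) (snd (quotient_of q)))"

definition rat_padic_abs :: "nat \<Rightarrow> rat \<Rightarrow> real" where
  "rat_padic_abs p q = (if q = 0 then 0 else real p powi (- rat_padic_val p q))"

lemma rat_padic_val_Fract:
  assumes "prime p" "a \<noteq> 0" "b \<noteq> 0"
  shows "rat_padic_val p (of_int a / of_int b) =
           int (multiplicity (int p) a) - int (multiplicity (int p) b)"
proof -
  obtain c d where cd: "quotient_of (of_int a / of_int b) = (c, d)" by (meson surj_pair)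
  have d: "d > 0" using quotient_of_denom_pos cd by blast
  have eq: "(of_int a / of_int b :: rat) = of_int c / of_int d"
    using quotient_of_div cd by blast
  hence "(of_int (a * d) :: rat) = of_int (c * b)"
    using d assms by (simp add: field_simps)
  hence e: "a * d = c * b" using of_int_eq_iff by blast
  have c: "c \<noteq> 0" using e assms d by auto
  have pe: "prime_elem (int p)" using assms(1) by simp
  have "multiplicity (int p) a + multiplicity (int p) d = multiplicity (int p) c + multiplicity (int p) b"
    using prime_elem_multiplicity_mult_distrib[OF pe] e assms c d
    by (metis less_irrefl)
  thus ?thesis unfolding rat_padic_val_def cd by simp
qed

lemma rat_padic_abs_0 [simp]: "rat_padic_abs p 0 = 0"
  by (simp add: rat_padic_abs_def)

lemma rat_padic_val_of_int:
  assumes "prime p" "a \<noteq> 0"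
  shows "rat_padic_val p (of_int a) = int (multiplicity (int p) a)"
  using rat_padic_val_Fract[OF assms, of 1] by simp

lemma rat_padic_abs_nonneg [simp]: "rat_padic_abs p q \<ge> 0"
  by (simp add: rat_padic_abs_def)

lemma rat_padic_abs_eq_0 [simp]: "prime p \<Longrightarrow> rat_padic_abs p q = 0 \<longleftrightarrow> q = 0"
  by (auto simp: rat_padic_abs_def power_int_eq_0_iff)

lemma rat_padic_val_mult:
  assumes "prime p" "x \<noteq> 0" "y \<noteq> 0"
  shows "rat_padic_val p (x * y) = rat_padic_val p x + rat_padic_val p y"
proof -
  have "\<exists>a b. z = of_int a / of_int b \<and> b > 0" for z :: rat
    using quotient_of_div[of z] quotient_of_denom_pos[of z] by (cases "quotient_of z") blast
  then obtain a b c d where x: "x = of_int a / of_int b" and b: "b > 0"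
      and y: "y = of_int c / of_int d" and d: "d > 0" by meson
  have nz: "a \<noteq> 0" "c \<noteq> 0" using x y assms by auto
  have pe: "prime_elem (int p)" using assms(1) by simp
  have "x * y = of_int (a * c) / of_int (b * d)" by (simp add: x y)
  hence "rat_padic_val p (x * y) =
      int (multiplicity (int p) (a * c)) - int (multiplicity (int p) (b * d))"
    using rat_padic_val_Fract[OF assms(1), of "a * c" "b * d"] nz b d by simp
  thus ?thesis
    using rat_padic_val_Fract[OF assms(1), of a b] rat_padic_val_Fract[OF assms(1), of c d]
      nz b d prime_elem_multiplicity_mult_distrib[OF pe] x y by simp
qed

lemma rat_padic_abs_mult:
  assumes "prime p"
  shows "rat_padic_abs p (x * y) = rat_padic_abs p x * rat_padic_abs p y"
  using assms prime_gt_0_nat[OF assms]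
  by (auto simp: rat_padic_abs_def rat_padic_val_mult power_int_add [symmetric])

lemma rat_padic_abs_1 [simp]: "prime p \<Longrightarrow> rat_padic_abs p 1 = 1"
  using rat_padic_val_of_int[of p 1] by (simp add: rat_padic_abs_def)

lemma rat_padic_abs_minus [simp]: "rat_padic_abs p (- x) = rat_padic_abs p x"
proof -
  have "multiplicity (int p) (- a) = multiplicity (int p) a" for a
    using multiplicity_normalize_right[of "int p" a] multiplicity_normalize_right[of "int p" "- a"]
    by simp
  thus ?thesis
    by (simp add: rat_padic_abs_def rat_padic_val_def rat_uminus_code case_prod_unfold Let_def)
qed

lemma rat_padic_abs_minus_commute: "rat_padic_abs p (x - y) = rat_padic_abs p (y - x)"
  using rat_padic_abs_minus[of p "x - y"] by simp

lemma rat_padic_abs_of_int_le_1: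
  assumes "prime p" shows "rat_padic_abs p (of_int a) \<le> 1"
proof (cases "a = 0")
  case False
  have "real p powi (- int k) \<le> 1" for k
    using prime_ge_1_nat[OF assms] by (simp add: power_int_minus field_simps)
  thus ?thesis using False by (simp add: rat_padic_abs_def rat_padic_val_of_int[OF assms])
qed auto

lemma rat_padic_abs_inverse:
  assumes "prime p"
  shows "rat_padic_abs p (inverse x) = inverse (rat_padic_abs p x)"
proof (cases "x = 0")
  case False
  thus ?thesis using rat_padic_abs_mult[OF assms, of x "inverse x"] assms
    by (simp add: inverse_unique)
qed auto

lemma rat_padic_abs_le_1_imp:
  assumes "prime p" "rat_padic_abs p x \<le> 1"
  shows "\<exists>a b. x = of_int a / of_int b \<and> \<not> int p dvd b"
proof -
  obtain a b where q: "quotient_of x = (a, b)" by (meson surj_pair)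
  have x: "x = of_int a / of_int b" using quotient_of_div q by blast
  have b: "b > 0" using quotient_of_denom_pos q by blast
  have cop: "coprime a b" using quotient_of_coprime q by blast
  have "\<not> int p dvd b"
  proof
    assume d: "int p dvd b"
    hence na: "\<not> int p dvd a" using cop assms(1)
      by (meson coprime_common_divisor not_prime_unit prime_nat_int_transfer)
    hence a: "a \<noteq> 0" by auto
    have "multiplicity (int p) b > 0"
      using d b assms(1) by (simp add: prime_multiplicity_gt_zero_iff)
    moreover have "multiplicity (int p) a = 0"
      using na by (simp add: not_dvd_imp_multiplicity_0)
    ultimately obtain k where k: "rat_padic_val p x = - int (Suc k)"
      using rat_padic_val_Fract[OF assms(1) a, of b] b x
      by (metis gr0_conv_Suc diff_0 less_irrefl of_nat_0)
    have "rat_padic_abs p x = real p ^ Suc k"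
      using k a x b by (simp add: rat_padic_abs_def power_int_def nat_add_distrib)
    moreover have "real p ^ Suc k > 1" using prime_gt_1_nat[OF assms(1)]
      by (intro one_less_power) auto
    ultimately show False using assms(2) by simp
  qed
  thus ?thesis using x by blast
qed

lemma rat_padic_abs_not_dvd:
  assumes "prime p" "\<not> int p dvd b"
  shows "rat_padic_abs p (of_int b) = 1"
proof -
  have "b \<noteq> 0" using assms by auto
  thus ?thesis using rat_padic_val_of_int[OF assms(1)] not_dvd_imp_multiplicity_0[OF assms(2)]
    by (simp add: rat_padic_abs_def)
qed

lemma rat_padic_abs_add_le_1:
  assumes p: "prime p" and "rat_padic_abs p x \<le> 1" "rat_padic_abs p y \<le> 1"
  shows "rat_padic_abs p (x + y) \<le> 1"
proof -
  obtain a b where x: "x = of_int a / of_int b" and b: "\<not> int p dvd b"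
    using rat_padic_abs_le_1_imp assms by blast
  obtain c d where y: "y = of_int c / of_int d" and d: "\<not> int p dvd d"
    using rat_padic_abs_le_1_imp assms by blast
  have "b \<noteq> 0" "d \<noteq> 0" using b d by auto
  hence "x + y = of_int (a * d + c * b) * inverse (of_int (b * d))"
    by (simp add: x y field_simps)
  moreover have "\<not> int p dvd b * d" using b d p by (simp add: prime_dvd_mult_iff)
  ultimately show ?thesis
    using rat_padic_abs_of_int_le_1[OF p, of "a * d + c * b"]
      rat_padic_abs_not_dvd[OF p, of "b * d"]
    by (simp only: rat_padic_abs_mult[OF p] rat_padic_abs_inverse[OF p]) simp
qed

lemma rat_padic_abs_add:
  assumes p: "prime p"
  shows "rat_padic_abs p (x + y) \<le> max (rat_padic_abs p x) (rat_padic_abs p y)"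
proof -
  have *: "rat_padic_abs p (x + y) \<le> rat_padic_abs p y"
    if le: "rat_padic_abs p x \<le> rat_padic_abs p y" for x y
  proof (cases "y = 0")
    case True
    thus ?thesis using le by simp
  next
    case False
    hence pos: "rat_padic_abs p y > 0"
      using rat_padic_abs_eq_0[OF p, of y] rat_padic_abs_nonneg[of p y] by linarith
    have "rat_padic_abs p (x / y) = rat_padic_abs p x / rat_padic_abs p y"
      by (simp only: divide_inverse rat_padic_abs_mult[OF p] rat_padic_abs_inverse[OF p])
    hence "rat_padic_abs p (x / y) \<le> 1" using le pos by simp
    hence "rat_padic_abs p (x / y + 1) \<le> 1" using rat_padic_abs_add_le_1[OF p] p by simp
    moreover have "x + y = (x / y + 1) * y" using False by (simp add: field_simps)
    ultimately show ?thesis using pos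
      using mult_right_mono[of "rat_padic_abs p (x / y + 1)" 1 "rat_padic_abs p y"]
      by (simp only: rat_padic_abs_mult[OF p]) simp
  qed
  show ?thesis using *[of x y] *[of y x] by (auto simp: add.commute max_def)
qed

lemma rat_padic_abs_triangle:
  "prime p \<Longrightarrow> rat_padic_abs p (x + y) \<le> rat_padic_abs p x + rat_padic_abs p y"
  using rat_padic_abs_add[of p x y] rat_padic_abs_nonneg[of p x] rat_padic_abs_nonneg[of p y]
  by linarith

lemma rat_padic_abs_add_eq:
  assumes p: "prime p" and lt: "rat_padic_abs p y < rat_padic_abs p x"
  shows "rat_padic_abs p (x + y) = rat_padic_abs p x"
  using rat_padic_abs_add[OF p, of x y] rat_padic_abs_add[OF p, of "x + y" "- y"] lt
  by auto

section \<open>Cauchy sequences\<close>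

definition padic_cauchy :: "nat \<Rightarrow> (nat \<Rightarrow> rat) \<Rightarrow> bool" where
  "padic_cauchy p X \<longleftrightarrow>
     (\<forall>e>0. \<exists>N. \<forall>m\<ge>N. \<forall>n\<ge>N. rat_padic_abs p (X m - X n) < e)"

definition padic_null :: "nat \<Rightarrow> (nat \<Rightarrow> rat) \<Rightarrow> bool" where
  "padic_null p X \<longleftrightarrow> (\<lambda>n. rat_padic_abs p (X n)) \<longlonglongrightarrow> 0"

definition padic_rel :: "nat \<Rightarrow> (nat \<Rightarrow> rat) \<Rightarrow> (nat \<Rightarrow> rat) \<Rightarrow> bool" where
  "padic_rel p X Y \<longleftrightarrow> padic_cauchy p X \<and> padic_cauchy p Y \<and> padic_null p (\<lambda>n. X n - Y n)"

lemma padic_cauchy_const [simp]: "padic_cauchy p (\<lambda>_. c)"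
  by (simp add: padic_cauchy_def)

lemma padic_null_0 [simp]: "padic_null p (\<lambda>_. 0)"
  by (simp add: padic_null_def)

lemma padic_null_const: "prime p \<Longrightarrow> padic_null p (\<lambda>_. c) \<longleftrightarrow> c = 0"
  by (simp add: padic_null_def LIMSEQ_const_iff)

lemma padic_null_minus: "padic_null p (\<lambda>n. - X n) \<longleftrightarrow> padic_null p X"
  by (simp add: padic_null_def)

lemma padic_null_minus_commute: "padic_null p (\<lambda>n. X n - Y n) \<longleftrightarrow> padic_null p (\<lambda>n. Y n - X n)"
  by (simp add: padic_null_def rat_padic_abs_minus_commute[of p "X _"])

lemma real_null_comparison:
  fixes f g :: "nat \<Rightarrow> real"
  assumes "\<And>n. 0 \<le> f n" "\<And>n. f n \<le> g n" "g \<longlonglongrightarrow> 0"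
  shows "f \<longlonglongrightarrow> 0"
  by (rule tendsto_sandwich[of "\<lambda>_. 0" f _ g]) (use assms in auto)

lemma padic_null_add:
  assumes "prime p" "padic_null p X" "padic_null p Y"
  shows "padic_null p (\<lambda>n. X n + Y n)"
proof -
  have "(\<lambda>n. rat_padic_abs p (X n) + rat_padic_abs p (Y n)) \<longlonglongrightarrow> 0 + 0"
    using assms unfolding padic_null_def by (intro tendsto_add)
  hence "(\<lambda>n. rat_padic_abs p (X n) + rat_padic_abs p (Y n)) \<longlonglongrightarrow> 0" by simp
  thus ?thesis unfolding padic_null_def
    by (rule real_null_comparison[rotated 2]) (auto intro!: rat_padic_abs_triangle assms)
qed

lemma padic_null_diff:
  assumes "prime p" "padic_null p X" "padic_null p Y"
  shows "padic_null p (\<lambda>n. X n - Y n)"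
  using padic_null_add[OF assms(1,2), of "\<lambda>n. - Y n"] assms(3) by (simp add: padic_null_minus)

lemma padic_cauchy_bounded:
  assumes p: "prime p" and "padic_cauchy p X"
  shows "\<exists>b>0. \<forall>n. rat_padic_abs p (X n) < b"
proof -
  obtain N where N: "\<And>m n. m \<ge> N \<Longrightarrow> n \<ge> N \<Longrightarrow> rat_padic_abs p (X m - X n) < 1"
    using assms(2) unfolding padic_cauchy_def by (meson zero_less_one)
  define B where "B = (\<Sum>k\<le>N. rat_padic_abs p (X k))"
  have B: "rat_padic_abs p (X k) \<le> B" if "k \<le> N" for k
    unfolding B_def using that by (intro member_le_sum) auto
  have B0: "B \<ge> 0" unfolding B_def by (intro sum_nonneg) auto
  have "rat_padic_abs p (X n) < B + 1" for n
  proof (cases "n \<le> N")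
    case True thus ?thesis using B[of n] by simp
  next
    case False
    thus ?thesis
      using rat_padic_abs_triangle[OF p, of "X n - X N" "X N"] N[of n N] B[of N] by simp
  qed
  thus ?thesis using B0 by (intro exI[of _ "B + 1"]) auto
qed

lemma padic_null_mult:
  assumes p: "prime p" and "padic_cauchy p X" "padic_null p Y"
  shows "padic_null p (\<lambda>n. X n * Y n)"
proof -
  obtain b where b: "b > 0" "\<And>n. rat_padic_abs p (X n) < b"
    using padic_cauchy_bounded[OF assms(1,2)] by blast
  have "(\<lambda>n. b * rat_padic_abs p (Y n)) \<longlonglongrightarrow> b * 0"
    using assms(3) unfolding padic_null_def by (intro tendsto_mult) auto
  hence "(\<lambda>n. b * rat_padic_abs p (Y n)) \<longlonglongrightarrow> 0" by simp
  thus ?thesis unfolding padic_null_def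
    by (rule real_null_comparison[rotated 2])
       (auto intro!: mult_right_mono less_imp_le[OF b(2)] simp: rat_padic_abs_mult[OF p])
qed

lemma padic_cauchy_minus: "padic_cauchy p X \<Longrightarrow> padic_cauchy p (\<lambda>n. - X n)"
  unfolding padic_cauchy_def by (simp only: minus_diff_minus rat_padic_abs_minus)

lemma padic_cauchy_add:
  assumes p: "prime p" and X: "padic_cauchy p X" and Y: "padic_cauchy p Y"
  shows "padic_cauchy p (\<lambda>n. X n + Y n)"
  unfolding padic_cauchy_def
proof (intro allI impI)
  fix e :: real assume e: "e > 0"
  obtain N where N: "\<And>m n. m \<ge> N \<Longrightarrow> n \<ge> N \<Longrightarrow> rat_padic_abs p (X m - X n) < e"
    using X e unfolding padic_cauchy_def by meson
  obtain M where M: "\<And>m n. m \<ge> M \<Longrightarrow> n \<ge> M \<Longrightarrow> rat_padic_abs p (Y m - Y n) < e"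
    using Y e unfolding padic_cauchy_def by meson
  have "rat_padic_abs p (X m + Y m - (X n + Y n)) < e" if "m \<ge> max M N" "n \<ge> max M N" for m n
    using rat_padic_abs_add[OF p, of "X m - X n" "Y m - Y n"] N[of m n] M[of m n] that
    by (simp add: algebra_simps)
  thus "\<exists>N. \<forall>m\<ge>N. \<forall>n\<ge>N. rat_padic_abs p (X m + Y m - (X n + Y n)) < e" by blast
qed

lemma padic_cauchy_mult:
  assumes p: "prime p" and X: "padic_cauchy p X" and Y: "padic_cauchy p Y"
  shows "padic_cauchy p (\<lambda>n. X n * Y n)"
  unfolding padic_cauchy_def
proof (intro allI impI)
  fix e :: real assume e: "e > 0"
  obtain b where b: "b > 0" "\<And>n. rat_padic_abs p (X n) < b"
    using padic_cauchy_bounded[OF p X] by blast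
  obtain c where c: "c > 0" "\<And>n. rat_padic_abs p (Y n) < c"
    using padic_cauchy_bounded[OF p Y] by blast
  have eb: "e / c > 0" "e / b > 0" using e b c by auto
  obtain N where N: "\<And>m n. m \<ge> N \<Longrightarrow> n \<ge> N \<Longrightarrow> rat_padic_abs p (X m - X n) < e / c"
    using X eb unfolding padic_cauchy_def by meson
  obtain M where M: "\<And>m n. m \<ge> M \<Longrightarrow> n \<ge> M \<Longrightarrow> rat_padic_abs p (Y m - Y n) < e / b"
    using Y eb unfolding padic_cauchy_def by meson
  have "rat_padic_abs p (X m * Y m - X n * Y n) < e" if mn: "m \<ge> max M N" "n \<ge> max M N" for m n
  proof -
    have "rat_padic_abs p (X m * (Y m - Y n)) < b * (e / b)"
      unfolding rat_padic_abs_mult[OF p] using b M[of m n] mn by (intro mult_strict_mono) auto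
    moreover have "rat_padic_abs p ((X m - X n) * Y n) < (e / c) * c"
      unfolding rat_padic_abs_mult[OF p] using c N[of m n] mn eb by (intro mult_strict_mono) auto
    moreover have "X m * Y m - X n * Y n = X m * (Y m - Y n) + (X m - X n) * Y n"
      by (simp add: algebra_simps)
    ultimately show ?thesis
      using rat_padic_abs_add[OF p, of "X m * (Y m - Y n)" "(X m - X n) * Y n"] b c by simp
  qed
  thus "\<exists>N. \<forall>m\<ge>N. \<forall>n\<ge>N. rat_padic_abs p (X m * Y m - X n * Y n) < e" by blast
qed

lemma padic_cauchy_not_null:
  assumes p: "prime p" and X: "padic_cauchy p X" and nz: "\<not> padic_null p X"
  shows "\<exists>b>0. \<exists>N. \<forall>n\<ge>N. rat_padic_abs p (X n) = b"
proof -
  obtain e where e: "e > 0" "\<And>N. \<exists>n\<ge>N. rat_padic_abs p (X n) \<ge> e"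
    using nz unfolding padic_null_def LIMSEQ_def dist_real_def
    by (auto simp: not_less)
  obtain N where N: "\<And>m n. m \<ge> N \<Longrightarrow> n \<ge> N \<Longrightarrow> rat_padic_abs p (X m - X n) < e"
    using X e(1) unfolding padic_cauchy_def by meson
  obtain M where M: "M \<ge> N" "rat_padic_abs p (X M) \<ge> e" using e(2) by blast
  have *: "rat_padic_abs p (X n) = rat_padic_abs p (X M)" if "n \<ge> M" for n
  proof -
    have "rat_padic_abs p (X n - X M) < rat_padic_abs p (X M)"
      using N[of n M] M that by linarith
    from rat_padic_abs_add_eq[OF p this] show ?thesis by simp
  qed
  have "rat_padic_abs p (X M) > 0" using M e(1) by linarith
  thus ?thesis using * by blast
qed

lemma padic_cauchy_inverse:
  assumes p: "prime p" and X: "padic_cauchy p X" and nz: "\<not> padic_null p X"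
  shows "padic_cauchy p (\<lambda>n. inverse (X n))"
  unfolding padic_cauchy_def
proof (intro allI impI)
  fix e :: real assume e: "e > 0"
  obtain b K where b: "b > 0" "\<And>n. n \<ge> K \<Longrightarrow> rat_padic_abs p (X n) = b"
    using padic_cauchy_not_null[OF assms] by blast
  have "e * b * b > 0" using e b by simp
  then obtain N where N: "\<And>m n. m \<ge> N \<Longrightarrow> n \<ge> N \<Longrightarrow> rat_padic_abs p (X m - X n) < e * b * b"
    using X unfolding padic_cauchy_def by meson
  have "rat_padic_abs p (inverse (X m) - inverse (X n)) < e"
    if mn: "m \<ge> max N K" "n \<ge> max N K" for m n
  proof -
    have "X m \<noteq> 0" "X n \<noteq> 0" using b(2)[of m] b(2)[of n] b(1) mn by auto
    hence "inverse (X m) - inverse (X n) = (X n - X m) * (inverse (X m) * inverse (X n))"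
      by (simp add: field_simps)
    hence "rat_padic_abs p (inverse (X m) - inverse (X n)) =
        rat_padic_abs p (X n - X m) * (inverse b * inverse b)"
      using b(2)[of m] b(2)[of n] mn
      by (simp only: rat_padic_abs_mult[OF p] rat_padic_abs_inverse[OF p])
    also have "\<dots> < (e * b * b) * (inverse b * inverse b)"
      using b N[of n m] mn by (intro mult_strict_right_mono) auto
    also have "\<dots> = e" using b(1) by (simp add: field_simps)
    finally show ?thesis .
  qed
  thus "\<exists>N. \<forall>m\<ge>N. \<forall>n\<ge>N. rat_padic_abs p (inverse (X m) - inverse (X n)) < e" by blast
qed

lemma padic_null_eventually:
  assumes "padic_null p X" "eventually (\<lambda>n. X n = Y n) sequentially"
  shows "padic_null p Y"
proof -
  have "eventually (\<lambda>n. rat_padic_abs p (X n) = rat_padic_abs p (Y n)) sequentially"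
    using assms(2) by eventually_elim simp
  thus ?thesis using assms(1) unfolding padic_null_def by (simp add: tendsto_cong)
qed

lemma padic_rel_null_iff:
  assumes "prime p" "padic_rel p X Y"
  shows "padic_null p X \<longleftrightarrow> padic_null p Y"
proof
  assume "padic_null p X"
  thus "padic_null p Y" using padic_null_diff[OF assms(1), of X "\<lambda>n. X n - Y n"] assms(2)
    by (simp add: padic_rel_def)
next
  assume "padic_null p Y"
  thus "padic_null p X" using padic_null_add[OF assms(1), of "\<lambda>n. X n - Y n" Y] assms(2)
    by (simp add: padic_rel_def)
qed

lemma padic_rel_inverse:
  assumes p: "prime p" and r: "padic_rel p X Y" and nz: "\<not> padic_null p X"
  shows "padic_rel p (\<lambda>n. inverse (X n)) (\<lambda>n. inverse (Y n))"
proof -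
  have X: "padic_cauchy p X" and Y: "padic_cauchy p Y"
    and XY: "padic_null p (\<lambda>n. X n - Y n)" using r by (auto simp: padic_rel_def)
  have nzY: "\<not> padic_null p Y" using padic_rel_null_iff[OF p r] nz by simp
  have iX: "padic_cauchy p (\<lambda>n. inverse (X n))" and iY: "padic_cauchy p (\<lambda>n. inverse (Y n))"
    using padic_cauchy_inverse p X Y nz nzY by auto
  have "padic_null p (\<lambda>n. (inverse (X n) * inverse (Y n)) * (Y n - X n))"
    using XY by (intro padic_null_mult padic_cauchy_mult p iX iY)
      (simp add: padic_null_minus_commute[of p Y])
  moreover have "eventually (\<lambda>n. (inverse (X n) * inverse (Y n)) * (Y n - X n) =
      inverse (X n) - inverse (Y n)) sequentially"
  proof -
    obtain b K where b: "b > 0" "\<And>n. n \<ge> K \<Longrightarrow> rat_padic_abs p (X n) = b"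
      using padic_cauchy_not_null[OF p X nz] by blast
    obtain c L where c: "c > 0" "\<And>n. n \<ge> L \<Longrightarrow> rat_padic_abs p (Y n) = c"
      using padic_cauchy_not_null[OF p Y nzY] by blast
    have "X n \<noteq> 0 \<and> Y n \<noteq> 0" if "n \<ge> max K L" for n
      using b c that by (metis less_irrefl max.boundedE rat_padic_abs_0)
    hence "eventually (\<lambda>n. X n \<noteq> 0 \<and> Y n \<noteq> 0) sequentially"
      unfolding eventually_sequentially by blast
    thus ?thesis by eventually_elim (simp add: field_simps)
  qed
  ultimately show ?thesis using padic_null_eventually iX iY by (auto simp: padic_rel_def)
qed

lemma part_equivp_padic_rel: "prime p \<Longrightarrow> part_equivp (padic_rel p)"
proof (rule part_equivpI)
  assume p: "prime p"
  show "\<exists>X. padic_rel p X X" by (rule exI[of _ "\<lambda>_. 0"]) (simp add: padic_rel_def)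
  show "symp (padic_rel p)"
    unfolding symp_def padic_rel_def using padic_null_minus_commute by blast
  show "transp (padic_rel p)"
  proof (rule transpI)
    fix X Y Z assume "padic_rel p X Y" "padic_rel p Y Z"
    thus "padic_rel p X Z"
      using padic_null_add[OF p, of "\<lambda>n. X n - Y n" "\<lambda>n. Y n - Z n"] by (simp add: padic_rel_def)
  qed
qed

section \<open>The field of p-adic numbers\<close>

text \<open>The prime is the cardinality of the index type \<open>'p\<close>; the field
  is the completion of the rationals for the p-adic absolute value.\<close>

typedef ('p :: prime_card) padic =
  "{C. \<exists>X. padic_rel CARD('p) X X \<and> C = Collect (padic_rel CARD('p) X)}"
  by (auto intro!: exI[of _ "\<lambda>_. 0"] simp: padic_rel_def)

definition Padic :: "(nat \<Rightarrow> rat) \<Rightarrow> 'p::prime_card padic" where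
  "Padic X = Abs_padic (Collect (padic_rel CARD('p) X))"

definition rep_padic :: "'p::prime_card padic \<Rightarrow> nat \<Rightarrow> rat" where
  "rep_padic x = (SOME X. X \<in> Rep_padic x)"

definition cr_padic :: "(nat \<Rightarrow> rat) \<Rightarrow> 'p::prime_card padic \<Rightarrow> bool" where
  "cr_padic = (\<lambda>X x. padic_rel CARD('p) X X \<and> Padic X = x)"

lemma Quotient_padic:
  "Quotient (padic_rel CARD('p)) (Padic :: (nat \<Rightarrow> rat) \<Rightarrow> 'p::prime_card padic) rep_padic cr_padic"
proof (rule QuotientI)
  let ?R = "padic_rel CARD('p)"
  have peq: "part_equivp ?R" by (rule part_equivp_padic_rel[OF prime_card])
  have sym: "?R Y X" if "?R X Y" for X Y using part_equivp_symp[OF peq, OF that] .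
  have trans: "?R X Z" if "?R X Y" "?R Y Z" for X Y Z using part_equivp_transp[OF peq, OF that] .
  have coll: "Collect (?R X) = Collect (?R Y)" if XY: "?R X Y" for X Y
    by (intro Collect_cong iffI) (rule trans[OF sym[OF XY]] trans[OF XY]; assumption)+
  have Rep: "?R (rep_padic a) (rep_padic a) \<and> Rep_padic a = Collect (?R (rep_padic a))"
    for a :: "'p padic"
  proof -
    obtain X where X: "?R X X" "Rep_padic a = Collect (?R X)" using Rep_padic[of a] by blast
    hence "rep_padic a \<in> Rep_padic a" unfolding rep_padic_def by (metis mem_Collect_eq someI)
    hence XR: "?R X (rep_padic a)" using X by simp
    show ?thesis using trans[OF sym[OF XR] XR] X(2)[unfolded coll[OF XR]] by (rule conjI)
  qed
  show "Padic (rep_padic a) = a" for a :: "'p padic"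
    using Rep[of a] Rep_padic_inverse[of a] by (simp add: Padic_def)
  show "?R (rep_padic a) (rep_padic a)" for a :: "'p padic" using Rep by blast
  show "?R X Y \<longleftrightarrow> ?R X X \<and> ?R Y Y \<and> (Padic X :: 'p padic) = Padic Y" for X Y
  proof
    assume XY: "?R X Y"
    show "?R X X \<and> ?R Y Y \<and> (Padic X :: 'p padic) = Padic Y"
      using trans[OF XY sym[OF XY]] trans[OF sym[OF XY] XY]
      unfolding Padic_def coll[OF XY] by blast
  next
    assume *: "?R X X \<and> ?R Y Y \<and> (Padic X :: 'p padic) = Padic Y"
    have mem: "Collect (?R Z) \<in> {C. \<exists>X. ?R X X \<and> C = Collect (?R X)}" if "?R Z Z" for Z
      using that by blast
    have "(Abs_padic (Collect (?R X)) :: 'p padic) = Abs_padic (Collect (?R Y))"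
      using * unfolding Padic_def by blast
    hence "Collect (?R X) = Collect (?R Y)"
      using Abs_padic_inject[OF mem mem] * by blast
    hence "Y \<in> Collect (?R X)" using * by blast
    thus "?R X Y" by blast
  qed
qed (simp add: cr_padic_def)

setup_lifting Quotient_padic

instantiation padic :: (prime_card) field
begin

lift_definition zero_padic :: "'a padic" is "\<lambda>_. 0" by (simp add: padic_rel_def)

lift_definition one_padic :: "'a padic" is "\<lambda>_. 1" by (simp add: padic_rel_def)

lift_definition plus_padic :: "'a padic \<Rightarrow> 'a padic \<Rightarrow> 'a padic" is "\<lambda>X Y n. X n + Y n"
  unfolding padic_rel_def add_diff_add
  by (simp add: padic_cauchy_add padic_null_add prime_card)

lift_definition uminus_padic :: "'a padic \<Rightarrow> 'a padic" is "\<lambda>X n. - X n"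
  unfolding padic_rel_def minus_diff_minus padic_null_minus
  by (simp add: padic_cauchy_minus)

lift_definition minus_padic :: "'a padic \<Rightarrow> 'a padic \<Rightarrow> 'a padic" is "\<lambda>X Y n. X n - Y n"
proof -
  fix X X' Y Y' :: "nat \<Rightarrow> rat"
  assume "padic_rel CARD('a) X X'" "padic_rel CARD('a) Y Y'"
  thus "padic_rel CARD('a) (\<lambda>n. X n - Y n) (\<lambda>n. X' n - Y' n)"
    using padic_cauchy_add[OF prime_card[where 'a='a], of X "\<lambda>n. - Y n"]
      padic_cauchy_add[OF prime_card[where 'a='a], of X' "\<lambda>n. - Y' n"]
      padic_null_diff[OF prime_card[where 'a='a], of "\<lambda>n. X n - X' n" "\<lambda>n. Y n - Y' n"]
    by (simp add: padic_rel_def padic_cauchy_minus algebra_simps)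
qed

lift_definition times_padic :: "'a padic \<Rightarrow> 'a padic \<Rightarrow> 'a padic" is "\<lambda>X Y n. X n * Y n"
proof -
  fix X X' Y Y' :: "nat \<Rightarrow> rat"
  assume r: "padic_rel CARD('a) X X'" "padic_rel CARD('a) Y Y'"
  note p = prime_card[where 'a='a]
  have "padic_null CARD('a) (\<lambda>n. X n * (Y n - Y' n) + Y' n * (X n - X' n))"
    using r unfolding padic_rel_def by (intro padic_null_add padic_null_mult p) auto
  thus "padic_rel CARD('a) (\<lambda>n. X n * Y n) (\<lambda>n. X' n * Y' n)"
    using r padic_cauchy_mult[OF p] by (simp add: padic_rel_def algebra_simps)
qed

lift_definition inverse_padic :: "'a padic \<Rightarrow> 'a padic"
  is "\<lambda>X. if padic_null CARD('a) X then (\<lambda>_. 0) else (\<lambda>n. inverse (X n))"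
proof -
  fix X Y :: "nat \<Rightarrow> rat"
  assume r: "padic_rel CARD('a) X Y"
  show "padic_rel CARD('a) (if padic_null CARD('a) X then (\<lambda>_. 0) else (\<lambda>n. inverse (X n)))
          (if padic_null CARD('a) Y then (\<lambda>_. 0) else (\<lambda>n. inverse (Y n)))"
    using padic_rel_inverse[OF prime_card r] padic_rel_null_iff[OF prime_card r]
    by (auto simp: padic_rel_def)
qed

definition "x div y = x * inverse y" for x y :: "'a padic"

instance
proof
  note p = prime_card[where 'a='a]
  have refl: "padic_rel CARD('a) X X" if "padic_cauchy CARD('a) X" for X
    using that by (simp add: padic_rel_def)
  note [simp] = padic_cauchy_add[OF p] padic_cauchy_mult[OF p] padic_cauchy_minus
  have cau: "padic_cauchy CARD('a) X" if "padic_rel CARD('a) X X" for X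
    using that by (simp add: padic_rel_def)
  fix a b c :: "'a padic"
  show "a * b * c = a * (b * c)"
    by transfer (auto intro!: refl dest!: cau simp: mult.assoc)
  show "a * b = b * a"
    by transfer (auto intro!: refl dest!: cau simp: mult.commute)
  show "1 * a = a"
    by transfer (auto intro!: refl dest!: cau)
  show "a + b + c = a + (b + c)"
    by transfer (auto intro!: refl dest!: cau simp: add.assoc)
  show "a + b = b + a"
    by transfer (auto intro!: refl dest!: cau simp: add.commute)
  show "0 + a = a"
    by transfer (auto intro!: refl dest!: cau)
  show "- a + a = 0"
    by transfer (auto intro!: refl dest!: cau)
  show "a - b = a + - b"
    by transfer (use padic_cauchy_add[OF p] padic_cauchy_minus[of "CARD('a)"] in
        \<open>fastforce simp: padic_rel_def\<close>)
  show "(a + b) * c = a * c + b * c"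
    by transfer (auto intro!: refl dest!: cau simp: distrib_right)
  show "(0 :: 'a padic) \<noteq> 1"
    by transfer (use p in \<open>simp add: padic_rel_def padic_null_const padic_null_minus\<close>)
  show "inverse (0 :: 'a padic) = 0"
    by transfer (simp add: padic_rel_def)
  show "a div b = a * inverse b" by (fact divide_padic_def)
  show "inverse a * a = 1" if "a \<noteq> 0"
    using that
  proof transfer
    fix X assume X: "padic_rel CARD('a) X X" and nz: "\<not> padic_rel CARD('a) X (\<lambda>_. 0)"
    have cX: "padic_cauchy CARD('a) X" using X by (rule cau)
    have nn: "\<not> padic_null CARD('a) X" using nz cX by (simp add: padic_rel_def)
    obtain b K where b: "b > 0" "\<And>n. n \<ge> K \<Longrightarrow> rat_padic_abs CARD('a) (X n) = b"
      using padic_cauchy_not_null[OF p cX nn] by blast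
    have "0 = inverse (X n) * X n - 1" if "n \<ge> K" for n
    proof -
      have "X n \<noteq> 0" using b(1) b(2)[OF that] by auto
      thus ?thesis by simp
    qed
    hence "eventually (\<lambda>n. 0 = inverse (X n) * X n - 1) sequentially"
      unfolding eventually_sequentially by blast
    from padic_null_eventually[OF padic_null_0 this]
    show "padic_rel CARD('a) (\<lambda>n. (if padic_null CARD('a) X then \<lambda>_. 0
            else (\<lambda>n. inverse (X n))) n * X n) (\<lambda>_. 1)"
      using nn cX padic_cauchy_inverse[OF p cX nn] by (simp add: padic_rel_def)
  qed
qed

end
section \<open>Absolute value, valuation and topology\<close>

lemma padic_rel_eventually_abs_eq:
  assumes p: "prime p" and r: "padic_rel p X Y" and nz: "\<not> padic_null p X"
  shows "eventually (\<lambda>n. X n \<noteq> 0 \<and> Y n \<noteq> 0 \<and> rat_padic_abs p (X n) = rat_padic_abs p (Y n)) sequentially"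
proof -
  have X: "padic_cauchy p X" and XY: "padic_null p (\<lambda>n. X n - Y n)"
    using r by (auto simp: padic_rel_def)
  obtain b K where b: "b > 0" "\<And>n. n \<ge> K \<Longrightarrow> rat_padic_abs p (X n) = b"
    using padic_cauchy_not_null[OF p X nz] by blast
  have "eventually (\<lambda>n. rat_padic_abs p (X n - Y n) < b) sequentially"
    using XY b(1) unfolding padic_null_def by (rule order_tendstoD)
  moreover have "eventually (\<lambda>n. n \<ge> K) sequentially" by (rule eventually_ge_at_top)
  ultimately show ?thesis
  proof eventually_elim
    case (elim n)
    have Xb: "rat_padic_abs p (X n) = b" using b(2) elim(2) by blast
    have "rat_padic_abs p (Y n - X n) < rat_padic_abs p (X n)"
      using elim(1) unfolding Xb rat_padic_abs_minus_commute[of p "Y n"] .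
    from rat_padic_abs_add_eq[OF p this]
    have "rat_padic_abs p (Y n) = b" using Xb by simp
    thus ?case using Xb b(1) by auto
  qed
qed

lemma rat_padic_abs_eq_imp_val_eq:
  assumes p: "prime p" and "x \<noteq> 0" "y \<noteq> 0" "rat_padic_abs p x = rat_padic_abs p y"
  shows "rat_padic_val p x = rat_padic_val p y"
proof -
  have "real p powi (- rat_padic_val p x) = real p powi (- rat_padic_val p y)"
    using assms by (simp add: rat_padic_abs_def)
  moreover have "real p > 1" using prime_gt_1_nat[OF p] by simp
  ultimately show ?thesis
    by (metis neg_equal_iff_equal linorder_neqE less_irrefl power_int_strict_increasing)
qed

text \<open>The valuation takes the conventional value \<open>0\<close> at \<open>0\<close> instead of \<open>\<infinity>\<close>.
  A Cauchy sequence that is not a null sequence has eventually constant valuation.\<close>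

lift_definition padic_val :: "'p::prime_card padic \<Rightarrow> int"
  is "\<lambda>X. if padic_null CARD('p) X then 0
          else (THE v. eventually (\<lambda>n. rat_padic_val CARD('p) (X n) = v) sequentially)"
proof -
  fix X Y :: "nat \<Rightarrow> rat"
  note p = prime_card[where 'a='p]
  assume r: "padic_rel CARD('p) X Y"
  show "(if padic_null CARD('p) X then 0
          else (THE v. eventually (\<lambda>n. rat_padic_val CARD('p) (X n) = v) sequentially)) =
        (if padic_null CARD('p) Y then 0
          else (THE v. eventually (\<lambda>n. rat_padic_val CARD('p) (Y n) = v) sequentially))"
  proof (cases "padic_null CARD('p) X")
    case False
    have ev: "eventually (\<lambda>n. rat_padic_val CARD('p) (X n) = rat_padic_val CARD('p) (Y n)) sequentially"
      using padic_rel_eventually_abs_eq[OF p r False]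
      by eventually_elim (use rat_padic_abs_eq_imp_val_eq[OF p] in blast)
    have "eventually (\<lambda>n. rat_padic_val CARD('p) (X n) = v) sequentially \<longleftrightarrow>
          eventually (\<lambda>n. rat_padic_val CARD('p) (Y n) = v) sequentially" for v
      by (rule eventually_cong[OF ev]) simp
    thus ?thesis using padic_rel_null_iff[OF p r] by simp
  qed (use padic_rel_null_iff[OF p r] in simp)
qed

definition padic_abs :: "'p::prime_card padic \<Rightarrow> real" where
  "padic_abs x = (if x = 0 then 0 else real CARD('p) powi (- padic_val x))"

lemma padic_cases:
  obtains X where "padic_cauchy CARD('p) X" "x = (Padic X :: 'p::prime_card padic)"
  using Quotient_abs_rep[OF Quotient_padic, of x] Quotient_rep_reflp[OF Quotient_padic, of x]
  unfolding padic_rel_def by metis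

lemma padic_rel_refl: "padic_cauchy p X \<Longrightarrow> padic_rel p X X"
  by (simp add: padic_rel_def)

lemma Padic_eq_iff:
  assumes "padic_cauchy CARD('p) X" "padic_cauchy CARD('p) Y"
  shows "(Padic X :: 'p::prime_card padic) = Padic Y \<longleftrightarrow> padic_null CARD('p) (\<lambda>n. X n - Y n)"
  using Quotient_rel[OF Quotient_padic[where 'p='p], of X Y] assms
  by (auto simp: padic_rel_def)

lemma Padic_eq_0_iff:
  "padic_cauchy CARD('p) X \<Longrightarrow> (Padic X :: 'p::prime_card padic) = 0 \<longleftrightarrow> padic_null CARD('p) X"
  using Padic_eq_iff[of X "\<lambda>_. 0", where 'p='p] by (simp add: zero_padic.abs_eq)

lemma padic_abs_Padic:
  assumes X: "padic_cauchy CARD('p) X"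
  shows "(\<lambda>n. rat_padic_abs CARD('p) (X n)) \<longlonglongrightarrow> padic_abs (Padic X :: 'p::prime_card padic)"
proof (cases "padic_null CARD('p) X")
  case True
  thus ?thesis using Padic_eq_0_iff[OF X] by (simp add: padic_abs_def padic_null_def)
next
  case False
  let ?p = "CARD('p)"
  note p = prime_card[where 'a='p]
  obtain b K where b: "b > 0" "\<And>n. n \<ge> K \<Longrightarrow> rat_padic_abs ?p (X n) = b"
    using padic_cauchy_not_null[OF p X False] by blast
  have nz: "X n \<noteq> 0" if "n \<ge> K" for n using b(1) b(2)[OF that] by auto
  define v where "v = rat_padic_val ?p (X K)"
  have v: "rat_padic_val ?p (X n) = v" if "n \<ge> K" for n
    unfolding v_def using that
    by (intro rat_padic_abs_eq_imp_val_eq[OF p] nz) (simp_all add: b)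
  have ev: "eventually (\<lambda>n. rat_padic_val ?p (X n) = v) sequentially"
    unfolding eventually_sequentially using v by blast
  have "(THE v. eventually (\<lambda>n. rat_padic_val ?p (X n) = v) sequentially) = v"
  proof (rule the_equality)
    show "eventually (\<lambda>n. rat_padic_val ?p (X n) = v) sequentially" by (rule ev)
    fix w assume "eventually (\<lambda>n. rat_padic_val ?p (X n) = w) sequentially"
    hence "eventually (\<lambda>n::nat. w = v) sequentially" using ev by eventually_elim simp
    thus "w = v" by simp
  qed
  hence "padic_val (Padic X :: 'p padic) = v"
    using False by (simp add: padic_val.abs_eq[OF padic_rel_refl[OF X]])
  hence "padic_abs (Padic X :: 'p padic) = b"
    using b(2)[of K] nz[of K] False Padic_eq_0_iff[OF X]
    by (simp add: padic_abs_def rat_padic_abs_def v_def)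
  moreover have "eventually (\<lambda>n. rat_padic_abs ?p (X n) = b) sequentially"
    unfolding eventually_sequentially using b(2) by blast
  ultimately show ?thesis by (simp add: tendsto_eventually)
qed

lemma padic_abs_nonneg [simp]: "padic_abs x \<ge> 0"
  by (simp add: padic_abs_def)

lemma padic_abs_eq_0 [simp]: "padic_abs (x :: 'p::prime_card padic) = 0 \<longleftrightarrow> x = 0"
  by (simp add: padic_abs_def)

lemma padic_abs_0 [simp]: "padic_abs 0 = 0"
  by (simp add: padic_abs_def)

lemma padic_abs_mult:
  fixes x y :: "'p::prime_card padic"
  shows "padic_abs (x * y) = padic_abs x * padic_abs y"
proof -
  note p = prime_card[where 'a='p]
  obtain X where X: "padic_cauchy CARD('p) X" "x = Padic X" by (rule padic_cases)
  obtain Y where Y: "padic_cauchy CARD('p) Y" "y = Padic Y" by (rule padic_cases)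
  have xy: "x * y = Padic (\<lambda>n. X n * Y n)"
    unfolding X Y by (rule times_padic.abs_eq) (use X Y padic_rel_refl in blast)+
  have "(\<lambda>n. rat_padic_abs CARD('p) (X n * Y n)) \<longlonglongrightarrow> padic_abs (x * y)"
    unfolding xy by (rule padic_abs_Padic padic_cauchy_mult p X Y)+
  moreover have "(\<lambda>n. rat_padic_abs CARD('p) (X n * Y n)) \<longlonglongrightarrow> padic_abs x * padic_abs y"
    unfolding rat_padic_abs_mult[OF p] X(2) Y(2)
    by (intro tendsto_mult padic_abs_Padic X Y)
  ultimately show ?thesis using LIMSEQ_unique by blast
qed

lemma padic_abs_add:
  fixes x y :: "'p::prime_card padic"
  shows "padic_abs (x + y) \<le> max (padic_abs x) (padic_abs y)"
proof -
  note p = prime_card[where 'a='p]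
  obtain X where X: "padic_cauchy CARD('p) X" "x = Padic X" by (rule padic_cases)
  obtain Y where Y: "padic_cauchy CARD('p) Y" "y = Padic Y" by (rule padic_cases)
  have xy: "x + y = Padic (\<lambda>n. X n + Y n)"
    unfolding X Y by (rule plus_padic.abs_eq) (use X Y padic_rel_refl in blast)+
  have "(\<lambda>n. rat_padic_abs CARD('p) (X n + Y n)) \<longlonglongrightarrow> padic_abs (x + y)"
    unfolding xy by (rule padic_abs_Padic padic_cauchy_add p X Y)+
  moreover have "(\<lambda>n. max (rat_padic_abs CARD('p) (X n)) (rat_padic_abs CARD('p) (Y n)))
      \<longlonglongrightarrow> max (padic_abs x) (padic_abs y)"
    unfolding X(2) Y(2) by (intro tendsto_max padic_abs_Padic X Y)
  ultimately show ?thesis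
    by (rule LIMSEQ_le) (use rat_padic_abs_add[OF p] in blast)
qed

lemma padic_abs_1 [simp]: "padic_abs (1 :: 'p::prime_card padic) = 1"
  using padic_abs_mult[of "1 :: 'p padic" 1] padic_abs_eq_0[of "1 :: 'p padic"] by simp

lemma padic_abs_minus [simp]: "padic_abs (- x :: 'p::prime_card padic) = padic_abs x"
proof -
  have "padic_abs (- 1 :: 'p padic) ^ 2 = 1"
    using padic_abs_mult[of "- 1 :: 'p padic" "- 1"] by (simp add: power2_eq_square)
  hence "padic_abs (- 1 :: 'p padic) = 1"
    using padic_abs_nonneg[of "- 1 :: 'p padic"] by (simp add: power2_eq_1_iff)
  thus ?thesis using padic_abs_mult[of "- 1" x] by simp
qed

lemma padic_abs_minus_commute: "padic_abs (x - y :: 'p::prime_card padic) = padic_abs (y - x)"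
  using padic_abs_minus[of "x - y"] by simp

lemma padic_abs_inverse: "padic_abs (inverse x :: 'p::prime_card padic) = inverse (padic_abs x)"
proof (cases "x = 0")
  case False
  hence "padic_abs x * padic_abs (inverse x) = 1" by (simp flip: padic_abs_mult)
  thus ?thesis by (metis inverse_unique)
next
  case True
  thus ?thesis by simp
qed

lemma padic_abs_divide: "padic_abs (x / y :: 'p::prime_card padic) = padic_abs x / padic_abs y"
  by (simp add: divide_inverse padic_abs_mult padic_abs_inverse)

lemma padic_abs_power: "padic_abs (x ^ n :: 'p::prime_card padic) = padic_abs x ^ n"
  by (induction n) (simp_all add: padic_abs_mult)

lemma padic_abs_power_int: "padic_abs (x powi k :: 'p::prime_card padic) = padic_abs x powi k"
  by (simp add: power_int_def padic_abs_power padic_abs_inverse)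

lemma padic_of_nat: "(of_nat n :: 'p::prime_card padic) = Padic (\<lambda>_. of_nat n)"
proof (induction n)
  case 0
  show ?case by (simp add: zero_padic.abs_eq)
next
  case (Suc n)
  have "1 + of_nat n = (Padic (\<lambda>_. 1 + of_nat n) :: 'p padic)"
    unfolding Suc one_padic.abs_eq
    by (rule plus_padic.abs_eq) (simp_all add: padic_rel_refl)
  thus ?case by simp
qed

instance padic :: (prime_card) field_char_0
proof
  show "inj (of_nat :: nat \<Rightarrow> 'a padic)"
  proof (rule injI)
    fix m n :: nat
    assume "(of_nat m :: 'a padic) = of_nat n"
    thus "m = n" unfolding padic_of_nat
      using padic_null_const[OF prime_card[where 'a='a]] by (simp add: Padic_eq_iff)
  qed
qed

lemma padic_abs_of_nat:
  "padic_abs (of_nat n :: 'p::prime_card padic) = rat_padic_abs CARD('p) (of_nat n)"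
  using LIMSEQ_unique[OF padic_abs_Padic[of "\<lambda>_. of_nat n", where 'p='p] tendsto_const]
  by (simp add: padic_of_nat)

lemma padic_abs_of_int:
  "padic_abs (of_int a :: 'p::prime_card padic) = rat_padic_abs CARD('p) (of_int a)"
proof (cases "a \<ge> 0")
  case True
  thus ?thesis using padic_abs_of_nat[of "nat a", where 'p='p] by simp
next
  case False
  thus ?thesis using padic_abs_of_nat[of "nat (- a)", where 'p='p] by simp
qed

lemma padic_abs_of_rat:
  "padic_abs (of_rat q :: 'p::prime_card padic) = rat_padic_abs CARD('p) q"
proof -
  note p = prime_card[where 'a='p]
  obtain a b where q: "q = of_int a / of_int b"
    using quotient_of_div[of q] by (cases "quotient_of q") blast
  have "(of_rat q :: 'p padic) = of_int a * inverse (of_int b)"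
    unfolding q of_rat_divide of_rat_of_int_eq by (rule divide_inverse)
  thus ?thesis unfolding q divide_inverse
    by (simp only: padic_abs_mult padic_abs_inverse padic_abs_of_int
        rat_padic_abs_mult[OF p] rat_padic_abs_inverse[OF p])
qed

lemma padic_of_int: "(of_int a :: 'p::prime_card padic) = Padic (\<lambda>_. of_int a)"
proof (cases "a \<ge> 0")
  case True
  thus ?thesis using padic_of_nat[of "nat a", where 'p='p] by simp
next
  case False
  have "- of_nat (nat (- a)) = (Padic (\<lambda>_. - of_nat (nat (- a))) :: 'p padic)"
    unfolding padic_of_nat by (rule uminus_padic.abs_eq) (simp add: padic_rel_refl)
  thus ?thesis using False by simp
qed

lemma padic_of_rat: "(of_rat q :: 'p::prime_card padic) = Padic (\<lambda>_. q)"
proof -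
  obtain a b where ab: "quotient_of q = (a, b)" by (meson surj_pair)
  have b: "b > 0" using quotient_of_denom_pos ab by blast
  have q: "q = of_int a / of_int b" using quotient_of_div ab by blast
  have "Padic (\<lambda>_. q) * of_int b = (Padic (\<lambda>_. q * of_int b) :: 'p padic)"
    unfolding padic_of_int by (rule times_padic.abs_eq) (simp_all add: padic_rel_refl)
  hence "Padic (\<lambda>_. q) * of_int b = (of_int a :: 'p padic)"
    using q b by (simp add: padic_of_int)
  thus ?thesis using q b by (simp add: of_rat_divide divide_eq_eq)
qed

instantiation padic :: (prime_card) metric_space
begin

definition dist_padic :: "'a padic \<Rightarrow> 'a padic \<Rightarrow> real" where
  "dist_padic x y = padic_abs (x - y)"

definition uniformity_padic :: "('a padic \<times> 'a padic) filter" where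
  "uniformity_padic = (INF e\<in>{0 <..}. principal {(x, y). dist x y < e})"

definition open_padic :: "'a padic set \<Rightarrow> bool" where
  "open_padic U \<longleftrightarrow> (\<forall>x\<in>U. eventually (\<lambda>(x', y). x' = x \<longrightarrow> y \<in> U) uniformity)"

instance
proof
  fix x y z :: "'a padic"
  show "dist x y = 0 \<longleftrightarrow> x = y" by (simp add: dist_padic_def)
  have "padic_abs (x - y) \<le> max (padic_abs (x - z)) (padic_abs (z - y))"
    using padic_abs_add[of "x - z" "z - y"] by simp
  thus "dist x y \<le> dist x z + dist y z"
    unfolding dist_padic_def padic_abs_minus_commute[of y z]
    using padic_abs_nonneg[of "x - z"] padic_abs_nonneg[of "z - y"] by linarith
qed (simp_all add: uniformity_padic_def open_padic_def)

end

lemma padic_rat_dense: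
  fixes x :: "'p::prime_card padic"
  assumes e: "e > 0"
  shows "\<exists>q. padic_abs (x - of_rat q) < e"
proof -
  note p = prime_card[where 'a='p]
  obtain X where X: "padic_cauchy CARD('p) X" "x = Padic X" by (rule padic_cases)
  obtain N where N: "\<And>m n. m \<ge> N \<Longrightarrow> n \<ge> N \<Longrightarrow> rat_padic_abs CARD('p) (X m - X n) < e / 2"
    using X(1) e unfolding padic_cauchy_def by (meson half_gt_zero)
  have "x - of_rat (X N) = Padic (\<lambda>n. X n - X N)"
    unfolding X(2) padic_of_rat
    by (rule minus_padic.abs_eq) (simp_all add: padic_rel_refl X(1))
  moreover have "padic_cauchy CARD('p) (\<lambda>n. X n - X N)"
    using X(1) unfolding padic_cauchy_def by simp
  ultimately have "(\<lambda>n. rat_padic_abs CARD('p) (X n - X N)) \<longlonglongrightarrow> padic_abs (x - of_rat (X N))"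
    using padic_abs_Padic by metis
  hence "padic_abs (x - of_rat (X N)) \<le> e / 2"
    by (rule LIMSEQ_le_const2) (use N less_imp_le in blast)
  thus ?thesis using e by (intro exI[of _ "X N"]) linarith
qed

section \<open>Browkin expansions\<close>

definition browkin_expansion :: "'p::prime_card padic \<Rightarrow> int \<Rightarrow> (int \<Rightarrow> int) \<Rightarrow> bool" where
  "browkin_expansion \<alpha> k x \<longleftrightarrow>
     (\<forall>j\<ge>k. 2 * \<bar>x j\<bar> < int CARD('p)) \<and>
     (\<lambda>i. of_int (x (k + int i)) * of_nat CARD('p) powi (k + int i)) sums \<alpha>"

text \<open>The index \<open>k\<close> in an expansion is not unique, since leading digits may vanish,
  but the sum of the terms with index \<open>j \<le> 0\<close> is determined by \<open>\<alpha>\<close> for odd \<open>p\<close>;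
  see \<open>browkin_s_eq\<close> and \<open>ex_browkin_expansion\<close> below.\<close>

definition browkin_s :: "'p::prime_card padic \<Rightarrow> 'p padic" where
  "browkin_s \<alpha> = (THE a. \<exists>k x. browkin_expansion \<alpha> k x \<and>
     a = (\<Sum>j=k..0. of_int (x j) * of_nat CARD('p) powi j))"

lemma padic_abs_p: "padic_abs (of_nat CARD('p) :: 'p::prime_card padic) = inverse (real CARD('p))"
proof -
  note p = prime_card[where 'a='p]
  have "rat_padic_val CARD('p) (of_int (int CARD('p))) = int (multiplicity (int CARD('p)) (int CARD('p)))"
    using prime_gt_0_nat[OF p] by (intro rat_padic_val_of_int p) simp
  also have "multiplicity (int CARD('p)) (int CARD('p)) = 1"
    using p by (intro multiplicity_prime) simp
  finally have "rat_padic_abs CARD('p) (of_nat CARD('p)) = real CARD('p) powi (- 1)"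
    using prime_gt_0_nat[OF p] by (simp add: rat_padic_abs_def)
  thus ?thesis by (simp add: padic_abs_of_nat power_int_minus)
qed

lemma padic_abs_p_powi:
  "padic_abs (of_nat CARD('p) powi k :: 'p::prime_card padic) = real CARD('p) powi (- k)"
  by (simp add: padic_abs_power_int padic_abs_p power_int_minus power_int_inverse)

lemma padic_abs_of_int_le_1: "padic_abs (of_int a :: 'p::prime_card padic) \<le> 1"
  using rat_padic_abs_of_int_le_1[OF prime_card[where 'a='p]] by (simp add: padic_abs_of_int)

lemma padic_abs_of_int_not_dvd:
  "\<not> int CARD('p) dvd a \<Longrightarrow> padic_abs (of_int a :: 'p::prime_card padic) = 1"
  using rat_padic_abs_not_dvd[OF prime_card[where 'a='p]] by (simp add: padic_abs_of_int)

lemma tendsto_padic_iff: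
  "(S \<longlonglongrightarrow> (\<alpha> :: 'p::prime_card padic)) \<longleftrightarrow> (\<lambda>n. padic_abs (S n - \<alpha>)) \<longlonglongrightarrow> 0"
  by (subst tendsto_dist_iff) (simp add: dist_padic_def)

lemma padic_digits_zero:
  fixes d :: "nat \<Rightarrow> int"
  defines "S \<equiv> (\<lambda>N. \<Sum>i<N. of_int (d i) * of_nat CARD('p) ^ i :: 'p::prime_card padic)"
  assumes d: "\<And>i. \<bar>d i\<bar> < int CARD('p)"
    and lim: "(\<lambda>N. padic_abs (S N)) \<longlonglongrightarrow> 0"
  shows "d m = 0"
proof (induction m rule: less_induct)
  case (less m)
  let ?P = "of_nat CARD('p) :: 'p padic"
  define r where "r = inverse (real CARD('p))"
  have r: "0 < r" "r < 1" unfolding r_def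
    using prime_gt_1_nat[OF prime_card[where 'a='p]] by (auto simp: field_simps)
  have absP: "padic_abs (?P ^ i) = r ^ i" for i
    by (simp add: padic_abs_power padic_abs_p r_def)
  have tail: "padic_abs (S (Suc m + n) - of_int (d m) * ?P ^ m) \<le> r ^ Suc m" for n
  proof (induction n)
    case 0
    have "(\<Sum>i<m. of_int (d i) * ?P ^ i) = 0"
      using less by (intro sum.neutral) simp
    hence "S (Suc m + 0) - of_int (d m) * ?P ^ m = 0" by (simp add: S_def)
    hence "padic_abs (S (Suc m + 0) - of_int (d m) * ?P ^ m) = 0" by (simp only: padic_abs_0)
    thus ?case using r by (simp del: padic_abs_eq_0)
  next
    case (Suc n)
    let ?t = "of_int (d (Suc m + n)) * ?P ^ (Suc m + n)"
    have "padic_abs ?t \<le> 1 * r ^ (Suc m + n)"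
      unfolding padic_abs_mult absP
      by (intro mult_right_mono padic_abs_of_int_le_1) (use r in simp)
    also have "\<dots> \<le> r ^ Suc m"
      using power_decreasing[of "Suc m" "Suc m + n" r] r by simp
    finally have t: "padic_abs ?t \<le> r ^ Suc m" .
    have "S (Suc m + Suc n) - of_int (d m) * ?P ^ m =
        (S (Suc m + n) - of_int (d m) * ?P ^ m) + ?t"
      by (simp add: S_def)
    thus ?case
      by (simp only:) (rule order.trans[OF padic_abs_add max.boundedI[OF Suc t]])
  qed
  show "d m = 0"
  proof (rule ccontr)
    assume nz: "d m \<noteq> 0"
    have "\<not> int CARD('p) dvd d m"
      using zdvd_not_zless[of "\<bar>d m\<bar>" "int CARD('p)"] nz d[of m] by auto
    hence abs: "padic_abs (of_int (d m) * ?P ^ m) = r ^ m"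
      by (simp add: padic_abs_mult padic_abs_of_int_not_dvd absP)
    have "eventually (\<lambda>N. padic_abs (S N) < r ^ m) sequentially"
      using lim by (rule order_tendstoD) (use r in simp)
    then obtain M where M: "\<And>N. N \<ge> M \<Longrightarrow> padic_abs (S N) < r ^ m"
      unfolding eventually_sequentially by blast
    have "padic_abs (S (Suc m + M)) < r ^ m" by (rule M) simp
    moreover have "r ^ Suc m < r ^ m" using r by (intro power_strict_decreasing) auto
    ultimately have "padic_abs (of_int (d m) * ?P ^ m) < r ^ m"
      using padic_abs_add[of "S (Suc m + M)" "of_int (d m) * ?P ^ m - S (Suc m + M)"] tail[of M]
        padic_abs_minus_commute[of "of_int (d m) * ?P ^ m" "S (Suc m + M)"]
      by (simp del: power_Suc)
    thus False using abs by simp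
  qed
qed

lemma sums_prepend_zeros:
  fixes f :: "nat \<Rightarrow> 'a :: {comm_monoid_add, topological_space}"
  assumes "(\<lambda>i. f (i + m)) sums s" "\<And>i. i < m \<Longrightarrow> f i = 0"
  shows "f sums s"
proof -
  have "sum f {..<n + m} = (\<Sum>i<n. f (i + m))" for n
    using assms(2) by (induction n) auto
  hence "(\<lambda>n. sum f {..<n + m}) \<longlonglongrightarrow> s" using assms(1) by (simp add: sums_def)
  thus ?thesis unfolding sums_def by (rule LIMSEQ_offset)
qed

lemma browkin_expansion_prepend:
  fixes \<alpha> :: "'p::prime_card padic"
  assumes x: "browkin_expansion \<alpha> k x" and K: "K \<le> k"
  defines "y \<equiv> (\<lambda>j. if j < k then 0 else x j)"
  shows "browkin_expansion \<alpha> K y"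
    "(\<Sum>j=K..0. of_int (y j) * of_nat CARD('p) powi j) =
     (\<Sum>j=k..0. of_int (x j) * of_nat CARD('p) powi j :: 'p padic)"
proof -
  have "(\<lambda>i. of_int (y (K + int i)) * of_nat CARD('p) powi (K + int i)) sums \<alpha>"
  proof (rule sums_prepend_zeros)
    show "(\<lambda>i. of_int (y (K + int (i + nat (k - K)))) *
        of_nat CARD('p) powi (K + int (i + nat (k - K)))) sums \<alpha>"
      using x K by (simp add: browkin_expansion_def y_def add.commute)
  qed (use K in \<open>auto simp: y_def\<close>)
  thus "browkin_expansion \<alpha> K y"
    using x prime_gt_0_nat[OF prime_card[where 'a='p]]
    by (auto simp: browkin_expansion_def y_def)
  show "(\<Sum>j=K..0. of_int (y j) * of_nat CARD('p) powi j) =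
     (\<Sum>j=k..0. of_int (x j) * of_nat CARD('p) powi j :: 'p padic)"
    by (rule sum.mono_neutral_cong_right) (use K in \<open>auto simp: y_def\<close>)
qed

lemma browkin_expansion_unique:
  fixes \<alpha> :: "'p::prime_card padic"
  assumes x: "browkin_expansion \<alpha> k x" and y: "browkin_expansion \<alpha> k y" and j: "j \<ge> k"
  shows "x j = y j"
proof -
  let ?P = "of_nat CARD('p) :: 'p padic"
  define d where "d = (\<lambda>i. x (k + int i) - y (k + int i))"
  define X where "X = (\<lambda>N. \<Sum>i<N. of_int (x (k + int i)) * ?P powi (k + int i))"
  define Y where "Y = (\<lambda>N. \<Sum>i<N. of_int (y (k + int i)) * ?P powi (k + int i))"
  have P: "?P \<noteq> 0" using prime_gt_0_nat[OF prime_card[where 'a='p]] by simp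
  have "(\<Sum>i<N. of_int (d i) * ?P ^ i) = (X N - Y N) * ?P powi (- k)" for N
  proof -
    have "?P powi (k + int i) * ?P powi (- k) = ?P ^ i" for i
      using P by (simp flip: power_int_add)
    thus ?thesis
      unfolding X_def Y_def d_def
      by (simp add: sum_distrib_right mult.assoc left_diff_distrib flip: sum_subtractf)
  qed
  hence eq: "padic_abs (\<Sum>i<N. of_int (d i) * ?P ^ i) =
      padic_abs (X N - Y N) * padic_abs (?P powi (- k))" for N
    by (simp only: padic_abs_mult)
  have lX: "(\<lambda>N. padic_abs (X N - \<alpha>)) \<longlonglongrightarrow> 0" and lY: "(\<lambda>N. padic_abs (Y N - \<alpha>)) \<longlonglongrightarrow> 0"
    using x y unfolding browkin_expansion_def sums_def X_def Y_def tendsto_padic_iff by auto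
  have "(\<lambda>N. padic_abs (X N - Y N)) \<longlonglongrightarrow> 0"
  proof (rule real_null_comparison)
    show "padic_abs (X N - Y N) \<le> max (padic_abs (X N - \<alpha>)) (padic_abs (Y N - \<alpha>))" for N
      using padic_abs_add[of "X N - \<alpha>" "\<alpha> - Y N"] padic_abs_minus_commute[of \<alpha> "Y N"] by simp
    show "(\<lambda>N. max (padic_abs (X N - \<alpha>)) (padic_abs (Y N - \<alpha>))) \<longlonglongrightarrow> 0"
      using tendsto_max[OF lX lY] by simp
  qed simp
  hence "(\<lambda>N. padic_abs (X N - Y N) * padic_abs (?P powi (- k))) \<longlonglongrightarrow> 0 * padic_abs (?P powi (- k))"
    by (intro tendsto_mult tendsto_const)
  hence "(\<lambda>N. padic_abs (\<Sum>i<N. of_int (d i) * ?P ^ i)) \<longlonglongrightarrow> 0"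
    unfolding eq by simp
  moreover have "\<bar>d i\<bar> < int CARD('p)" for i
  proof -
    have "2 * \<bar>x (k + int i)\<bar> < int CARD('p)" "2 * \<bar>y (k + int i)\<bar> < int CARD('p)"
      using x y unfolding browkin_expansion_def by auto
    thus ?thesis unfolding d_def by linarith
  qed
  ultimately have "d (nat (j - k)) = 0" using padic_digits_zero[where 'p='p] by blast
  thus ?thesis using j by (simp add: d_def)
qed

lemma browkin_s_eq:
  fixes \<alpha> :: "'p::prime_card padic"
  assumes x: "browkin_expansion \<alpha> k x"
  shows "browkin_s \<alpha> = (\<Sum>j=k..0. of_int (x j) * of_nat CARD('p) powi j)"
  unfolding browkin_s_def
proof (rule the_equality)
  fix a :: "'p padic"
  assume "\<exists>k x. browkin_expansion \<alpha> k x \<and> a = (\<Sum>j=k..0. of_int (x j) * of_nat CARD('p) powi j)"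
  then obtain l y where y: "browkin_expansion \<alpha> l y"
    and a: "a = (\<Sum>j=l..0. of_int (y j) * of_nat CARD('p) powi j)" by blast
  note x' = browkin_expansion_prepend[OF x, of "min k l"]
  note y' = browkin_expansion_prepend[OF y, of "min k l"]
  have "(\<Sum>j=min k l..0. of_int (if j < k then 0 else x j) * of_nat CARD('p) powi j) =
      (\<Sum>j=min k l..0. of_int (if j < l then 0 else y j) * of_nat CARD('p) powi j :: 'p padic)"
  proof (rule sum.cong[OF refl])
    fix j assume "j \<in> {min k l..0}"
    hence "(if j < k then 0 else x j) = (if j < l then 0 else y j)"
      using browkin_expansion_unique[OF x'(1) y'(1), of j] by simp
    thus "of_int (if j < k then 0 else x j) * of_nat CARD('p) powi j =
      (of_int (if j < l then 0 else y j) * of_nat CARD('p) powi j :: 'p padic)" by simp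
  qed
  thus "a = (\<Sum>j=k..0. of_int (x j) * of_nat CARD('p) powi j)"
    using x'(2) y'(2) a by simp
qed (use x in blast)

lemma ex_padic_digit:
  fixes \<alpha> :: "'p::prime_card padic"
  assumes odd: "odd CARD('p)" and le: "padic_abs \<alpha> \<le> 1"
  shows "\<exists>d. 2 * \<bar>d\<bar> < int CARD('p) \<and> padic_abs (\<alpha> - of_int d) \<le> inverse (real CARD('p))"
proof -
  note p = prime_card[where 'a='p]
  let ?p = "int CARD('p)"
  define r where "r = inverse (real CARD('p))"
  have r: "0 < r" "r < 1" unfolding r_def
    using prime_gt_1_nat[OF p] by (auto simp: field_simps)
  have absp: "padic_abs (of_int (?p * t) :: 'p padic) \<le> r" for t
  proof -
    have "padic_abs (of_nat CARD('p) * of_int t :: 'p padic) \<le> r * 1"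
      unfolding padic_abs_mult padic_abs_p r_def[symmetric]
      by (intro mult_left_mono padic_abs_of_int_le_1) (use r in simp)
    thus ?thesis by simp
  qed
  obtain q where q: "padic_abs (\<alpha> - of_rat q) < r" using padic_rat_dense r by blast
  have "padic_abs (of_rat q :: 'p padic) \<le> 1"
    using padic_abs_add[of \<alpha> "of_rat q - \<alpha>"] padic_abs_minus_commute[of \<alpha> "of_rat q"] q r le
    by simp
  hence "rat_padic_abs CARD('p) q \<le> 1" by (simp add: padic_abs_of_rat)
  then obtain a b where ab: "q = of_int a / of_int b" "\<not> ?p dvd b"
    using rat_padic_abs_le_1_imp[OF p] by blast
  have "coprime b ?p" using ab(2) p
    by (metis coprime_commute prime_imp_coprime prime_nat_int_transfer)
  then obtain u v where uv: "b * u + ?p * v = 1"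
    using bezout_int[of b ?p] by (auto simp: coprime_iff_gcd_eq_1 mult.commute)
  define h where "h = (?p - 1) div 2"
  have h: "?p = 2 * h + 1" using odd unfolding h_def by (auto elim!: oddE)
  define d where "d = (a * u + h) mod ?p - h"
  have d: "2 * \<bar>d\<bar> < ?p"
  proof -
    define e where "e = (a * u + h) mod ?p"
    have "0 \<le> e" "e < 2 * h + 1"
      using prime_gt_0_nat[OF p] unfolding e_def h[symmetric] by simp_all
    hence "2 * \<bar>e - h\<bar> < 2 * h + 1" by arith
    thus ?thesis unfolding d_def e_def h[symmetric] .
  qed
  have "a * u - d = ?p * ((a * u + h) div ?p)"
    unfolding d_def by (simp add: minus_mod_eq_mult_div algebra_simps)
  hence 2: "padic_abs (of_int (a * u - d) :: 'p padic) \<le> r" using absp by metis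
  have b: "(of_int b :: 'p padic) \<noteq> 0" using ab(2) by auto
  have "a - a * u * b = ?p * (a * v)"
  proof -
    have "a = a * (b * u + ?p * v)" using uv by simp
    thus ?thesis by (simp add: algebra_simps)
  qed
  hence "padic_abs (of_int (a - a * u * b) :: 'p padic) \<le> r" using absp by metis
  moreover have "of_rat q - of_int (a * u) = (of_int (a - a * u * b) / of_int b :: 'p padic)"
    using b by (simp add: ab(1) of_rat_divide field_simps)
  ultimately have 1: "padic_abs (of_rat q - of_int (a * u) :: 'p padic) \<le> r"
    using padic_abs_of_int_not_dvd[OF ab(2)] by (simp only: padic_abs_divide div_by_1)
  have "padic_abs (of_rat q - of_int d :: 'p padic) \<le> r"
    using padic_abs_add[of "of_rat q - of_int (a * u) :: 'p padic" "of_int (a * u - d)"] 1 2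
    by simp
  hence "padic_abs (\<alpha> - of_int d) \<le> r"
    using padic_abs_add[of "\<alpha> - of_rat q" "of_rat q - of_int d"] q by simp
  thus ?thesis using d unfolding r_def by blast
qed

lemma ex_browkin_expansion:
  fixes \<alpha> :: "'p::prime_card padic"
  assumes odd: "odd CARD('p)"
  shows "\<exists>k x. browkin_expansion \<alpha> k x"
proof -
  let ?P = "of_nat CARD('p) :: 'p padic"
  define r where "r = inverse (real CARD('p))"
  have r: "0 < r" "r < 1" unfolding r_def
    using prime_gt_1_nat[OF prime_card[where 'a='p]] by (auto simp: field_simps)
  have P: "?P \<noteq> 0" using prime_gt_0_nat[OF prime_card[where 'a='p]] by simp
  define k where "k = padic_val \<alpha>"
  define dig where "dig = (\<lambda>\<beta> :: 'p padic. SOME d. 2 * \<bar>d\<bar> < int CARD('p) \<and>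
    padic_abs (\<beta> - of_int d) \<le> r)"
  have dig: "2 * \<bar>dig \<beta>\<bar> < int CARD('p)" "padic_abs (\<beta> - of_int (dig \<beta>)) \<le> r"
    if "padic_abs \<beta> \<le> 1" for \<beta> :: "'p padic"
    using someI_ex[OF ex_padic_digit[OF odd that]] unfolding dig_def r_def by auto
  define b where "b = rec_nat (\<alpha> * ?P powi (- k)) (\<lambda>_ \<beta>. (\<beta> - of_int (dig \<beta>)) / ?P)"
  have b0: "b 0 = \<alpha> * ?P powi (- k)" and bSuc: "b (Suc n) = (b n - of_int (dig (b n))) / ?P" for n
    by (simp_all add: b_def)
  have "padic_abs (b 0) \<le> 1"
  proof (cases "\<alpha> = 0")
    case True
    thus ?thesis by (simp add: b0)
  next
    case False
    hence "padic_abs (b 0) = real CARD('p) powi (- k) * real CARD('p) powi k"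
      unfolding b0 padic_abs_mult padic_abs_p_powi by (simp add: padic_abs_def k_def)
    also have "\<dots> = 1" by (simp add: power_int_minus)
    finally show ?thesis by simp
  qed
  hence b1: "padic_abs (b n) \<le> 1" for n
  proof (induction n)
    case (Suc n)
    have "padic_abs (b (Suc n)) = padic_abs (b n - of_int (dig (b n))) / r"
      unfolding bSuc padic_abs_divide padic_abs_p r_def ..
    also have "\<dots> \<le> 1" using dig(2)[OF Suc.IH[OF Suc.prems]] r by simp
    finally show ?case .
  qed
  define x where "x = (\<lambda>j. dig (b (nat (j - k))))"
  define S where "S = (\<lambda>N. \<Sum>i<N. of_int (x (k + int i)) * ?P powi (k + int i))"
  have S: "\<alpha> = S N + ?P powi (k + int N) * b N" for N
  proof (induction N)
    case 0
    show ?case using P by (simp add: S_def b0 mult.left_commute flip: power_int_add)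
  next
    case (Suc N)
    have "?P powi (k + int (Suc N)) = ?P powi (k + int N) * ?P"
      using P by (simp add: power_int_add mult.assoc mult.commute add.commute[of 1])
    hence "?P powi (k + int (Suc N)) * b (Suc N) =
        ?P powi (k + int N) * (b N - of_int (dig (b N)))"
      unfolding bSuc using P by simp
    moreover have "S (Suc N) = S N + of_int (dig (b N)) * ?P powi (k + int N)"
      by (simp add: S_def x_def)
    ultimately show ?case using Suc by (simp add: algebra_simps)
  qed
  have "(\<lambda>N. padic_abs (S N - \<alpha>)) \<longlonglongrightarrow> 0"
  proof (rule real_null_comparison)
    fix N
    have "S N - \<alpha> = - (?P powi (k + int N) * b N)" using S[of N] by (simp add: algebra_simps)
    hence "padic_abs (S N - \<alpha>) = padic_abs (?P powi k) * r ^ N * padic_abs (b N)"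
      using P by (simp add: padic_abs_mult power_int_add padic_abs_power padic_abs_p r_def)
    also have "\<dots> \<le> padic_abs (?P powi k) * r ^ N * 1"
      using b1 r by (intro mult_left_mono) auto
    finally show "padic_abs (S N - \<alpha>) \<le> padic_abs (?P powi k) * r ^ N" by simp
  next
    have "(\<lambda>N. padic_abs (?P powi k) * r ^ N) \<longlonglongrightarrow> padic_abs (?P powi k) * 0"
      using r by (intro tendsto_mult tendsto_const LIMSEQ_realpow_zero) auto
    thus "(\<lambda>N. padic_abs (?P powi k) * r ^ N) \<longlonglongrightarrow> 0" by simp
  qed simp
  hence "browkin_expansion \<alpha> k x"
    using dig(1)[OF b1] unfolding browkin_expansion_def sums_def tendsto_padic_iff S_def x_def
    by auto
  thus ?thesis by blast
qed

section \<open>The p-adic Jacobi--Perron algorithm of dimension two\<close>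

text \<open>The complete quotients are iterated unconditionally. If the algorithm stops, this
  continues with the convention \<open>x / 0 = 0\<close>; up to and including the first
  index that meets the stopping condition, and hence for all indices if there is
  none, the values are those of the algorithm.\<close>

definition jp_step :: "'p::prime_card padic \<times> 'p padic \<Rightarrow> 'p padic \<times> 'p padic" where
  "jp_step = (\<lambda>(\<alpha>, \<beta>). (1 / (\<beta> - browkin_s \<beta>), (\<alpha> - browkin_s \<alpha>) / (\<beta> - browkin_s \<beta>)))"

definition jp_complete :: "'p::prime_card padic \<times> 'p padic \<Rightarrow> nat \<Rightarrow> 'p padic \<times> 'p padic" where
  "jp_complete \<alpha> n = (jp_step ^^ n) \<alpha>"

definition jp_partial1 :: "'p::prime_card padic \<times> 'p padic \<Rightarrow> nat \<Rightarrow> 'p padic" where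
  "jp_partial1 \<alpha> n = browkin_s (fst (jp_complete \<alpha> n))"

definition jp_partial2 :: "'p::prime_card padic \<times> 'p padic \<Rightarrow> nat \<Rightarrow> 'p padic" where
  "jp_partial2 \<alpha> n = browkin_s (snd (jp_complete \<alpha> n))"

definition jp_stops :: "'p::prime_card padic \<times> 'p padic \<Rightarrow> bool" where
  "jp_stops \<alpha> \<longleftrightarrow> (\<exists>n. snd (jp_complete \<alpha> n) = jp_partial2 \<alpha> n)"

end

theory Submission
  imports Defs
begin

text \<open>
  Suppose that \<open>v_p(a_n^(1)) = -1\<close> for only finitely many \<open>n\<close>. For \<open>n \<ge> 1\<close> the difference
  \<open>\<alpha>_(n-1)^(2) - a_(n-1)^(2)\<close> has positive valuation, so its inverse \<open>\<alpha>_n^(1)\<close>, and with it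
  \<open>a_n^(1)\<close>, has negative valuation. Hence \<open>v_p(a_n^(1)) \<le> -2\<close> from some index on.

  A rational relation \<open>c0 + c1 \<alpha>1 + c2 \<alpha>2 = 0\<close> is carried by each step of the algorithm to a relation
  between the next complete quotients. The coefficients of all these relations are consecutive
  terms of one rational sequence,
  \<open>u_(n+2) \<alpha>_n^(1) + u_(n+1) \<alpha>_n^(2) + u_n = 0\<close> with
  \<open>u_(n+3) = a_n^(1) u_(n+2) + a_n^(2) u_(n+1) + u_n\<close>, and subtracting the relation from
  the recurrence gives the second form
  \<open>u_(n+3) = - u_(n+2) (\<alpha>_n^(1) - a_n^(1)) - u_(n+1) (\<alpha>_n^(2) - a_n^(2))\<close>.

  The two forms measure \<open>u\<close> in two ways. In the second one the differences have valuations at least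
  \<open>1\<close> and \<open>- v_p(a_(n+1)^(1)) \<ge> 2\<close>, so \<open>v_p(u_n) \<ge> n - c\<close> for a constant \<open>c\<close>
  (\<open>ultrametric_recurrence_decay\<close>). In the first one the partial quotients are
  elements of \<open>\<int>[1/p]\<close> of ordinary absolute value at most \<open>p/2\<close> (\<open>browkin_s_rational\<close>), and
  for \<open>p \<ge> 3\<close> this forces \<open>u_n\<close> to grow more slowly than \<open>p ^ n\<close> (\<open>recurrence_growth\<close>). So, up to
  a fixed factor, \<open>u_n / p ^ n\<close> is an integer that tends to \<open>0\<close>, and \<open>u_n = 0\<close> for large \<open>n\<close>
  (\<open>padic_archimedean_eventually_zero\<close>). The recurrence determines \<open>u_n\<close> from the three terms
  after it, so all terms vanish, including \<open>u_0 = c0\<close>, \<open>u_1 = c2\<close> and \<open>u_2 = c1\<close>: the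
  relation was trivial.
\<close>

section \<open>Rationals with denominator a power of p\<close>

text \<open>The ring \<open>\<int>[1/p]\<close>, as a subset of the rationals.\<close>

definition ints_inverting :: "nat \<Rightarrow> rat set" where
  "ints_inverting p = {q. \<exists>k. of_nat p ^ k * q \<in> \<int>}"

lemma ints_inverting_int: "q \<in> \<int> \<Longrightarrow> q \<in> ints_inverting p"
  unfolding ints_inverting_def by (auto intro: exI[of _ 0])

lemma ints_inverting_add:
  assumes "x \<in> ints_inverting p" "y \<in> ints_inverting p"
  shows "x + y \<in> ints_inverting p"
proof -
  obtain k l where k: "of_nat p ^ k * x \<in> \<int>" and l: "of_nat p ^ l * y \<in> \<int>"
    using assms unfolding ints_inverting_def by blast
  have "of_nat p ^ (k + l) * (x + y) =
      of_nat p ^ l * (of_nat p ^ k * x) + of_nat p ^ k * (of_nat p ^ l * y)"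
    by (simp add: power_add algebra_simps)
  also have "\<dots> \<in> \<int>" by (rule Ints_add; rule Ints_mult) (use k l in \<open>auto intro: Ints_power\<close>)
  finally show ?thesis unfolding ints_inverting_def by blast
qed

lemma ints_inverting_mult:
  assumes "x \<in> ints_inverting p" "y \<in> ints_inverting p"
  shows "x * y \<in> ints_inverting p"
proof -
  obtain k l where k: "of_nat p ^ k * x \<in> \<int>" and l: "of_nat p ^ l * y \<in> \<int>"
    using assms unfolding ints_inverting_def by blast
  have "of_nat p ^ (k + l) * (x * y) = (of_nat p ^ k * x) * (of_nat p ^ l * y)"
    by (simp add: power_add algebra_simps)
  also have "\<dots> \<in> \<int>" using k l by (rule Ints_mult)
  finally show ?thesis unfolding ints_inverting_def by blast
qed

lemma ints_inverting_sum:
  "(\<And>i. i \<in> A \<Longrightarrow> f i \<in> ints_inverting p) \<Longrightarrow> sum f A \<in> ints_inverting p"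
  by (induction A rule: infinite_finite_induct)
     (auto intro: ints_inverting_add ints_inverting_int)

lemma powi_in_ints_inverting:
  assumes "p > 0"
  shows "of_nat p powi j \<in> ints_inverting p"
proof (cases "j \<ge> 0")
  case True
  thus ?thesis by (auto simp: power_int_def intro!: ints_inverting_int)
next
  case False
  hence "of_nat p ^ nat (- j) * (of_nat p powi j :: rat) = 1"
    using assms by (simp add: power_int_def field_simps)
  thus ?thesis unfolding ints_inverting_def by (intro CollectI exI[of _ "nat (- j)"]) simp
qed

lemma rat_padic_abs_prime_powi:
  assumes p: "prime p"
  shows "rat_padic_abs p (of_nat p powi j) = real p powi (- j)"
proof -
  have "rat_padic_val p (of_int (int p)) = 1"
    using p prime_gt_0_nat[OF p] by (subst rat_padic_val_of_int) auto
  hence base: "rat_padic_abs p (of_nat p) = inverse (real p)"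
    using prime_gt_0_nat[OF p] by (simp add: rat_padic_abs_def power_int_minus)
  have "rat_padic_abs p (of_nat p ^ k) = inverse (real p) ^ k" for k
    by (induction k) (simp_all add: rat_padic_abs_mult[OF p] base rat_padic_abs_1[OF p])
  thus ?thesis
    by (simp add: power_int_def power_inverse rat_padic_abs_inverse[OF p] rat_padic_abs_1[OF p])
qed

text \<open>Being \<open>p\<close>-adically integral excludes \<open>p\<close> from the denominator, and \<open>p\<close> is the only prime
  that elements of \<open>\<int>[1/p]\<close> can have there.\<close>

lemma ints_inverting_integral_imp_int:
  assumes p: "prime p" and x: "x \<in> ints_inverting p" and le: "rat_padic_abs p x \<le> 1"
  shows "x \<in> \<int>"
proof -
  obtain a b where ab: "x = of_int a / of_int b" and ndvd: "\<not> int p dvd b"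
    using rat_padic_abs_le_1_imp[OF p le] by blast
  obtain k where k: "of_nat p ^ k * x \<in> \<int>" using x unfolding ints_inverting_def by blast
  then obtain m where m: "of_nat p ^ k * x = of_int m" by (elim Ints_cases)
  have b: "b \<noteq> 0" using ndvd by auto
  have "(of_int (int p ^ k * a) :: rat) = of_int (m * b)"
    using m b by (simp add: ab field_simps)
  hence "int p ^ k * a = m * b" by (simp only: of_int_eq_iff)
  hence "b dvd int p ^ k * a" by simp
  moreover have "coprime b (int p ^ k)"
    using ndvd p by (metis coprime_commute coprime_power_right_iff prime_imp_coprime
        prime_nat_int_transfer)
  ultimately have "b dvd a" by (simp add: coprime_dvd_mult_right_iff)
  thus ?thesis using b by (auto simp: ab elim!: dvdE)
qed

section \<open>Browkin's truncation\<close>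

lemma padic_abs_sum_le:
  fixes f :: "'a \<Rightarrow> 'p::prime_card padic"
  assumes "c \<ge> 0" "\<And>i. i \<in> A \<Longrightarrow> padic_abs (f i) \<le> c"
  shows "padic_abs (sum f A) \<le> c"
  using assms
proof (induction A rule: infinite_finite_induct)
  case (insert i A)
  have "padic_abs (f i + sum f A) \<le> max (padic_abs (f i)) (padic_abs (sum f A))"
    by (rule padic_abs_add)
  also have "\<dots> \<le> c" using insert by simp
  finally show ?case using insert by simp
qed simp_all

text \<open>The geometric series with ratio \<open>1/t\<close>. Digits of absolute value at most
  \<open>(p - 1) / 2\<close> turn it, for \<open>t = p\<close>, into the bound \<open>p / 2\<close> for Browkin's truncations.\<close>

lemma sum_inverse_powers_le:
  assumes "(t :: rat) > 1"
  shows "(t - 1) * (\<Sum>j=-int m..0. t powi j) \<le> t"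
proof -
  have "(t - 1) * (\<Sum>j=-int m..0. t powi j) = t - t powi (- int m)"
  proof (induction m)
    case (Suc m)
    have "{- int (Suc m)..0} = insert (- int (Suc m)) {- int m..0}" by auto
    moreover have "t powi (- int m) = t powi (- int (Suc m)) * t"
      using assms by (subst power_int_add_1[symmetric]) auto
    ultimately show ?case using Suc by (simp add: algebra_simps)
  qed (simp add: algebra_simps)
  thus ?thesis using assms by simp
qed

text \<open>The truncation is a finite sum of digits times powers of \<open>p\<close>, which makes it an element of
  \<open>\<int>[1/p]\<close> and, by the geometric series, small; the discarded terms all contain the
  factor \<open>p\<close>.\<close>

lemma browkin_s_rational:
  fixes \<alpha> :: "'p::prime_card padic"
  assumes odd: "odd CARD('p)"
  shows "\<exists>q. browkin_s \<alpha> = of_rat q \<and> q \<in> ints_inverting CARD('p) \<and>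
    2 * \<bar>q\<bar> \<le> of_nat CARD('p) \<and>
    padic_abs (\<alpha> - browkin_s \<alpha>) \<le> inverse (real CARD('p))"
proof -
  let ?p = "CARD('p)"
  let ?P = "of_nat CARD('p) :: 'p padic"
  have p1: "?p > 1" using prime_gt_1_nat[OF prime_card[where 'a='p]] .
  obtain k0 x0 where x0: "browkin_expansion \<alpha> k0 x0" using ex_browkin_expansion[OF odd] by blast
  \<comment> \<open>Padding with zeros makes the first index nonpositive, so that the truncation is an initial
    segment of the series.\<close>
  define m where "m = nat (- k0)"
  obtain x where x: "browkin_expansion \<alpha> (- int m) x"
  proof
    have "- int m \<le> k0" by (simp add: m_def)
    thus "browkin_expansion \<alpha> (- int m) (\<lambda>j. if j < k0 then 0 else x0 j)"
      by (rule browkin_expansion_prepend(1)[OF x0])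
  qed
  have dig: "2 * \<bar>x j\<bar> < int ?p" if "j \<ge> - int m" for j
    using x that by (simp add: browkin_expansion_def)
  define q where "q = (\<Sum>j=-int m..0. of_int (x j) * of_nat ?p powi j :: rat)"
  have s: "browkin_s \<alpha> = (\<Sum>j=-int m..0. of_int (x j) * ?P powi j)"
    by (rule browkin_s_eq[OF x])
  have powi: "of_rat (of_nat ?p powi j) = (?P powi j)" for j
    by (simp add: power_int_def of_rat_power of_rat_inverse)
  have 1: "browkin_s \<alpha> = of_rat q"
    unfolding s q_def by (simp add: of_rat_sum of_rat_mult powi)
  have 2: "q \<in> ints_inverting ?p"
    unfolding q_def using p1
    by (intro ints_inverting_sum ints_inverting_mult powi_in_ints_inverting ints_inverting_int) auto
  have 3: "2 * \<bar>q\<bar> \<le> of_nat ?p"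
  proof -
    have "2 * \<bar>q\<bar> \<le> (\<Sum>j=-int m..0. 2 * \<bar>of_int (x j) * of_nat ?p powi j\<bar>)"
      unfolding q_def sum_distrib_left[symmetric] by simp
    also have "\<dots> \<le> (\<Sum>j=-int m..0. (of_nat ?p - 1) * of_nat ?p powi j)"
    proof (rule sum_mono)
      fix j assume "j \<in> {-int m..0}"
      hence "2 * \<bar>x j\<bar> \<le> int ?p - 1" using dig[of j] by simp
      hence "of_int (2 * \<bar>x j\<bar>) \<le> (of_int (int ?p - 1) :: rat)" by (simp only: of_int_le_iff)
      hence "of_int (2 * \<bar>x j\<bar>) * of_nat ?p powi j \<le> ((of_nat ?p - 1) * of_nat ?p powi j :: rat)"
        by (intro mult_right_mono) auto
      thus "2 * \<bar>of_int (x j) * of_nat ?p powi j\<bar> \<le> ((of_nat ?p - 1) * of_nat ?p powi j :: rat)"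
        by (simp add: abs_mult)
    qed
    also have "\<dots> \<le> of_nat ?p"
      using sum_inverse_powers_le[of "of_nat ?p" m] p1 by (simp flip: sum_distrib_left)
    finally show ?thesis .
  qed
  have 4: "padic_abs (\<alpha> - browkin_s \<alpha>) \<le> inverse (real ?p)"
  proof -
    define t where "t = (\<lambda>i. of_int (x (- int m + int i)) * ?P powi (- int m + int i))"
    have s': "browkin_s \<alpha> = sum t {..<Suc m}"
      unfolding s t_def
      by (rule sum.reindex_bij_witness[of _ "\<lambda>i. - int m + int i" "\<lambda>j. nat (j + int m)"]) auto
    have "(\<lambda>N. padic_abs (sum t {..<N} - \<alpha>)) \<longlonglongrightarrow> 0"
      using x unfolding browkin_expansion_def sums_def tendsto_padic_iff t_def by blast
    hence "eventually (\<lambda>N. padic_abs (sum t {..<N} - \<alpha>) < inverse (real ?p)) sequentially"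
      by (rule order_tendstoD) (use p1 in simp)
    then obtain N where N: "N \<ge> Suc m" "padic_abs (sum t {..<N} - \<alpha>) < inverse (real ?p)"
      unfolding eventually_sequentially by (meson le_cases order_refl)
    have "{..<N} - {..<Suc m} = {Suc m..<N}" by auto
    hence "sum t {..<N} - browkin_s \<alpha> = sum t {Suc m..<N}"
      unfolding s' using sum_diff[of "{..<N}" "{..<Suc m}" t] N(1) by auto
    moreover have "padic_abs (sum t {Suc m..<N}) \<le> inverse (real ?p)"
    proof (rule padic_abs_sum_le)
      fix i assume "i \<in> {Suc m..<N}"
      hence i: "- (- int m + int i) \<le> -1" by simp
      have "padic_abs (t i) \<le> 1 * real ?p powi (- (- int m + int i))"
        unfolding t_def padic_abs_mult padic_abs_p_powi
        by (intro mult_right_mono padic_abs_of_int_le_1) auto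
      also have "\<dots> \<le> real ?p powi (-1)"
        using power_int_increasing[OF i, of "real ?p"] p1 by simp
      finally show "padic_abs (t i) \<le> inverse (real ?p)" by (simp add: power_int_minus)
    qed simp
    ultimately have "padic_abs (sum t {..<N} - browkin_s \<alpha>) \<le> inverse (real ?p)" by simp
    moreover have "padic_abs (\<alpha> - sum t {..<N}) \<le> inverse (real ?p)"
      using N(2) padic_abs_minus_commute[of \<alpha> "sum t {..<N}"] by simp
    moreover have "\<alpha> - browkin_s \<alpha> = (\<alpha> - sum t {..<N}) + (sum t {..<N} - browkin_s \<alpha>)" by simp
    ultimately show ?thesis
      by (simp only:) (rule order.trans[OF padic_abs_add max.boundedI])
  qed
  show ?thesis using 1 2 3 4 by blast
qed

lemma padic_abs_diff_browkin_s:
  "odd CARD('p) \<Longrightarrow> padic_abs (\<alpha> - browkin_s \<alpha>) \<le> inverse (real CARD('p))"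
  for \<alpha> :: "'p::prime_card padic"
  using browkin_s_rational by blast

lemma padic_abs_browkin_s:
  fixes \<alpha> :: "'p::prime_card padic"
  assumes odd: "odd CARD('p)" and gt: "padic_abs \<alpha> > 1"
  shows "padic_abs (browkin_s \<alpha>) = padic_abs \<alpha>"
proof -
  have "inverse (real CARD('p)) \<le> 1"
    using prime_ge_1_nat[OF prime_card[where 'a='p]] by (simp add: inverse_le_1_iff)
  hence d: "padic_abs (\<alpha> - browkin_s \<alpha>) < padic_abs \<alpha>"
    using padic_abs_diff_browkin_s[OF odd, of \<alpha>] gt by linarith
  have "padic_abs (browkin_s \<alpha>) \<le> padic_abs \<alpha>"
    using padic_abs_add[of \<alpha> "browkin_s \<alpha> - \<alpha>"] padic_abs_minus_commute[of \<alpha>] d by simp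
  moreover have "padic_abs \<alpha> \<le> padic_abs (browkin_s \<alpha>)"
    using padic_abs_add[of "\<alpha> - browkin_s \<alpha>" "browkin_s \<alpha>"] d by simp
  ultimately show ?thesis by simp
qed

section \<open>Growth and decay along the recurrence\<close>

text \<open>The inequality \<open>p/2 t^2 + p/2 t + 1 \<le> t^3\<close> has a solution
  \<open>t < p\<close> as soon as \<open>1/2 + 1/(2 p) + 1/p^3 < 1\<close>. For \<open>p \<ge> 3\<close> this sum is at
  most \<open>19/27\<close>, which is below \<open>(9/10)^3\<close>; hence the choice \<open>t = 9/10 p\<close>.\<close>

lemma recurrence_growth:
  fixes f :: "nat \<Rightarrow> real" and p :: real
  assumes p: "p \<ge> 3" and nonneg: "\<And>n. f n \<ge> 0"
    and rec: "\<And>n. f (n + 3) \<le> p / 2 * f (n + 2) + p / 2 * f (n + 1) + f n"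
  shows "\<exists>K. \<forall>n. f n \<le> K * (9 / 10 * p) ^ n"
proof -
  define t where "t = 9 / 10 * p"
  have t: "t \<ge> 1" using p by (simp add: t_def)
  have key: "p / 2 * t\<^sup>2 + p / 2 * t + 1 \<le> t ^ 3"
  proof -
    have "3 * p\<^sup>2 \<le> p * p\<^sup>2" using p by (intro mult_right_mono) auto
    moreover have "9 \<le> p\<^sup>2" using power_mono[OF p, of 2] by simp
    ultimately show ?thesis unfolding t_def by (simp add: power2_eq_square power3_eq_cube)
  qed
  define K where "K = f 0 + f 1 + f 2"
  have K: "K \<ge> 0" using nonneg by (simp add: K_def)
  have "f n \<le> K * t ^ n \<and> f (n + 1) \<le> K * t ^ (n + 1) \<and> f (n + 2) \<le> K * t ^ (n + 2)" for n
  proof (induction n)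
    case 0
    have "K * 1 \<le> K * t ^ i" for i using K t by (intro mult_left_mono) auto
    from this[of 0] this[of 1] this[of 2]
    have "K \<le> K * t ^ 0" "K \<le> K * t ^ 1" "K \<le> K * t ^ 2" by simp_all
    moreover have "f 0 \<le> K" "f 1 \<le> K" "f 2 \<le> K" using nonneg by (simp_all add: K_def)
    ultimately have "f 0 \<le> K * t ^ 0" "f 1 \<le> K * t ^ 1" "f 2 \<le> K * t ^ 2"
      by (meson order_trans)+
    thus ?case by (simp add: numeral_2_eq_2)
  next
    case (Suc n)
    have "f (n + 3) \<le> p / 2 * (K * t ^ (n + 2)) + p / 2 * (K * t ^ (n + 1)) + K * t ^ n"
      using rec[of n] Suc p
      by (smt (verit) divide_nonneg_pos mult_left_mono)
    also have "\<dots> = K * t ^ n * (p / 2 * t\<^sup>2 + p / 2 * t + 1)"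
      by (simp add: power_add power2_eq_square algebra_simps)
    also have "\<dots> \<le> K * t ^ n * t ^ 3" using key K t by (intro mult_left_mono) auto
    finally have "f (n + 3) \<le> K * t ^ (n + 3)" by (simp add: power_add mult.assoc)
    thus ?case using Suc by (simp add: numeral_2_eq_2 numeral_3_eq_3)
  qed
  thus ?thesis unfolding t_def by blast
qed

text \<open>The factors \<open>1/p\<close> and \<open>1/p^2\<close> are those that make \<open>g n * p ^ n\<close> bounded by the
  maximum of its two predecessors. With \<open>1/p\<close> in both places only a decay like
  \<open>p ^ (- n / 2)\<close> would follow, which does not compensate the growth of the coefficients; this is
  where partial quotients of valuation \<open>-1\<close> matter.\<close>

lemma ultrametric_recurrence_decay:
  fixes g :: "nat \<Rightarrow> real"
  assumes p: "p > 0"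
    and rec: "\<And>n. n \<ge> N \<Longrightarrow> g (n + 2) \<le> max (g (n + 1) / p) (g n / p\<^sup>2)"
  shows "\<exists>M. \<forall>n\<ge>N. g n * p ^ n \<le> M"
proof -
  define M where "M = max (g N * p ^ N) (g (N + 1) * p ^ (N + 1))"
  have "g n * p ^ n \<le> M \<and> g (n + 1) * p ^ (n + 1) \<le> M" if "n \<ge> N" for n
    using that
  proof (induction n rule: dec_induct)
    case base
    show ?case by (simp add: M_def)
  next
    case (step n)
    have "g (n + 2) * p ^ (n + 2) \<le> max (g (n + 1) / p) (g n / p\<^sup>2) * p ^ (n + 2)"
      using rec[OF step.hyps(1)] p by (intro mult_right_mono) auto
    also have "\<dots> = max (g (n + 1) * p ^ (n + 1)) (g n * p ^ n)"
      using p by (simp add: max_mult_distrib_right power_add power2_eq_square)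
    also have "\<dots> \<le> M" using step.IH by simp
    finally show ?case using step.IH by simp
  qed
  thus ?thesis by blast
qed

lemma common_denominator:
  fixes x y z :: rat
  shows "\<exists>D::int. D > 0 \<and> of_int D * x \<in> \<int> \<and> of_int D * y \<in> \<int> \<and> of_int D * z \<in> \<int>"
proof -
  have "\<exists>d::int. d > 0 \<and> of_int d * q \<in> \<int>" for q :: rat
    by (metis (no_types, lifting) Ints_of_int nonzero_mult_div_cancel_left of_int_eq_0_iff
        order_less_irrefl quotient_of_denom_pos quotient_of_div surj_pair times_divide_eq_right)
  then obtain a b c :: int where abc: "a > 0" "b > 0" "c > 0"
      "of_int a * x \<in> \<int>" "of_int b * y \<in> \<int>" "of_int c * z \<in> \<int>" by meson
  have "of_int (a * b * c) * x = of_int (b * c) * (of_int a * x)"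
       "of_int (a * b * c) * y = of_int (a * c) * (of_int b * y)"
       "of_int (a * b * c) * z = of_int (a * b) * (of_int c * z)"
    by (simp_all add: algebra_simps)
  hence "of_int (a * b * c) * x \<in> \<int>" "of_int (a * b * c) * y \<in> \<int>" "of_int (a * b * c) * z \<in> \<int>"
    using abc by (metis Ints_mult Ints_of_int)+
  thus ?thesis using abc by (intro exI[of _ "a * b * c"]) simp
qed

text \<open>A nonzero integer has absolute value at least \<open>1\<close>. The numbers \<open>D p^c u_n / p^n\<close> are
  integers by the \<open>p\<close>-adic bound and tend to \<open>0\<close> like \<open>r ^ n\<close> by the archimedean one.\<close>

lemma padic_archimedean_eventually_zero:
  fixes u :: "nat \<Rightarrow> rat"
  assumes p: "prime p" and D: "D > 0"
    and int: "\<And>n. of_int D * u n \<in> ints_inverting p"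
    and padic: "\<And>n. n \<ge> N \<Longrightarrow> rat_padic_abs p (u n) * real p ^ n \<le> M"
    and arch: "\<And>n. real_of_rat \<bar>u n\<bar> \<le> K * (r * real p) ^ n"
    and r: "0 \<le> r" "r < 1"
  shows "eventually (\<lambda>n. u n = 0) sequentially"
proof -
  have p1: "real p > 1" using prime_gt_1_nat[OF p] by simp
  have p0: "p > 0" using prime_gt_0_nat[OF p] .
  obtain c where c: "M < real p ^ c" using real_arch_pow[OF p1] by blast
  define s where "s = (\<lambda>n. of_nat p powi (int c - int n) :: rat)"
  define y where "y = (\<lambda>n. of_int D * u n * s n)"
  have y_int: "y n \<in> \<int>" if "n \<ge> N" for n
  proof (rule ints_inverting_integral_imp_int[OF p])
    show "y n \<in> ints_inverting p"
      unfolding y_def s_def by (intro ints_inverting_mult int powi_in_ints_inverting p0)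
    have "rat_padic_abs p (y n) =
        rat_padic_abs p (of_int D) * (rat_padic_abs p (u n) * real p powi (int n - int c))"
      unfolding y_def s_def rat_padic_abs_mult[OF p] rat_padic_abs_prime_powi[OF p] by (simp add: mult.assoc)
    also have "\<dots> \<le> 1 * (rat_padic_abs p (u n) * real p powi (int n - int c))"
      by (intro mult_right_mono rat_padic_abs_of_int_le_1[OF p] mult_nonneg_nonneg) auto
    also have "\<dots> = rat_padic_abs p (u n) * real p ^ n / real p ^ c"
      using p1 by (simp add: power_int_diff)
    also have "\<dots> \<le> M / real p ^ c"
      using padic[OF that] p1 by (intro divide_right_mono) auto
    also have "\<dots> \<le> 1" using c p1 by simp
    finally show "rat_padic_abs p (y n) \<le> 1" .
  qed
  have y_le: "real_of_rat \<bar>y n\<bar> \<le> (of_int D * real p ^ c * K) * r ^ n" for n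
  proof -
    have "\<bar>y n\<bar> = of_int D * of_nat p ^ c * \<bar>u n\<bar> / of_nat p ^ n"
      using D p0 by (simp add: y_def s_def abs_mult power_int_diff)
    hence "real_of_rat \<bar>y n\<bar> = of_int D * real p ^ c * real_of_rat \<bar>u n\<bar> / real p ^ n"
      by (simp only: of_rat_mult of_rat_divide of_rat_power of_rat_of_int_eq of_rat_of_nat_eq)
    also have "\<dots> \<le> of_int D * real p ^ c * (K * (r * real p) ^ n) / real p ^ n"
      using D by (intro divide_right_mono mult_left_mono arch) auto
    also have "\<dots> = (of_int D * real p ^ c * K) * r ^ n"
      using p1 by (simp add: power_mult_distrib)
    finally show ?thesis .
  qed
  have "(\<lambda>n. (of_int D * real p ^ c * K) * r ^ n) \<longlonglongrightarrow> (of_int D * real p ^ c * K) * 0"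
    using r by (intro tendsto_mult tendsto_const LIMSEQ_realpow_zero)
  hence "eventually (\<lambda>n. (of_int D * real p ^ c * K) * r ^ n < 1) sequentially"
    by (intro order_tendstoD) auto
  moreover have "eventually (\<lambda>n. n \<ge> N) sequentially" by (rule eventually_ge_at_top)
  ultimately show ?thesis
  proof eventually_elim
    case (elim n)
    obtain z where z: "y n = of_int z" using y_int[OF elim(2)] by (elim Ints_cases)
    have "real_of_rat \<bar>y n\<bar> = of_int \<bar>z\<bar>" unfolding z by (metis of_int_abs of_rat_of_int_eq)
    hence "z = 0" using y_le[of n] elim(1) by simp
    thus ?case using z D p0 by (simp add: y_def s_def)
  qed
qed

section \<open>Linear relations between the complete quotients\<close>

text \<open>The coefficients of the relation after \<open>n\<close> steps are the terms of index \<open>n + 2\<close>, \<open>n + 1\<close>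
  and \<open>n\<close>, belonging to the first complete quotient, the second one and \<open>1\<close>; this is why \<open>c2\<close>
  comes before \<open>c1\<close>.\<close>

fun relation_coeff :: "rat \<Rightarrow> rat \<Rightarrow> rat \<Rightarrow> (nat \<Rightarrow> rat) \<Rightarrow> (nat \<Rightarrow> rat) \<Rightarrow> nat \<Rightarrow> rat" where
  "relation_coeff c0 c1 c2 a b 0 = c0"
| "relation_coeff c0 c1 c2 a b (Suc 0) = c2"
| "relation_coeff c0 c1 c2 a b (Suc (Suc 0)) = c1"
| "relation_coeff c0 c1 c2 a b (Suc (Suc (Suc n))) =
     a n * relation_coeff c0 c1 c2 a b (Suc (Suc n)) +
     b n * relation_coeff c0 c1 c2 a b (Suc n) + relation_coeff c0 c1 c2 a b n"

lemma jp_complete_Suc: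
  "fst (jp_complete \<alpha> (Suc n)) = 1 / (snd (jp_complete \<alpha> n) - jp_partial2 \<alpha> n)"
  "snd (jp_complete \<alpha> (Suc n)) =
     (fst (jp_complete \<alpha> n) - jp_partial1 \<alpha> n) / (snd (jp_complete \<alpha> n) - jp_partial2 \<alpha> n)"
  by (simp_all add: jp_complete_def jp_step_def jp_partial1_def jp_partial2_def case_prod_unfold)

theorem corollary3:
  fixes \<alpha>1 \<alpha>2 :: "'p::prime_card padic"
  assumes "odd CARD('p)"
    and "\<exists>c0 c1 c2 :: rat. \<not> (c0 = 0 \<and> c1 = 0 \<and> c2 = 0) \<and>
           of_rat c0 * 1 + of_rat c1 * \<alpha>1 + of_rat c2 * \<alpha>2 = 0"
    and "\<not> jp_stops (\<alpha>1, \<alpha>2)"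
  shows "infinite {n. padic_val (jp_partial1 (\<alpha>1, \<alpha>2) n) = - 1}"
proof
  assume fin: "finite {n. padic_val (jp_partial1 (\<alpha>1, \<alpha>2) n) = - 1}"
  note p = prime_card[where 'a='p]
  let ?p = "CARD('p)"
  have p3: "real ?p \<ge> 3"
    using prime_ge_2_nat[OF p] assms(1) by (cases "?p = 2") auto
  define A where "A = jp_partial1 (\<alpha>1, \<alpha>2)"
  define B where "B = jp_partial2 (\<alpha>1, \<alpha>2)"
  define X where "X = (\<lambda>n. fst (jp_complete (\<alpha>1, \<alpha>2) n))"
  define Y where "Y = (\<lambda>n. snd (jp_complete (\<alpha>1, \<alpha>2) n))"
  have X_Suc: "X (Suc n) = 1 / (Y n - B n)" and Y_Suc: "Y (Suc n) = (X n - A n) / (Y n - B n)" for n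
    unfolding X_def Y_def A_def B_def by (rule jp_complete_Suc)+
  have A_eq: "A n = browkin_s (X n)" and B_eq: "B n = browkin_s (Y n)" for n
    by (simp_all add: A_def B_def X_def Y_def jp_partial1_def jp_partial2_def)
  have nz: "Y n - B n \<noteq> 0" for n
    using assms(3) unfolding jp_stops_def Y_def B_def by auto
  have XA: "padic_abs (X n - A n) \<le> inverse (real ?p)"
    and YB: "padic_abs (Y n - B n) \<le> inverse (real ?p)" for n
    unfolding A_eq B_eq by (rule padic_abs_diff_browkin_s[OF assms(1)])+
  obtain N where N: "\<And>n. n \<ge> N \<Longrightarrow> padic_val (A n) \<noteq> - 1"
    using fin unfolding A_def finite_nat_set_iff_bounded by (auto simp: not_less[symmetric])
  \<comment> \<open>The inverse of this difference is the next first complete quotient, whose valuation is that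
    of its partial quotient: negative, and by the choice of \<open>N\<close> not \<open>-1\<close>.\<close>
  have YB2: "padic_abs (Y n - B n) \<le> inverse ((real ?p)\<^sup>2)" if "n \<ge> N" for n
  proof -
    have "real ?p * padic_abs (Y n - B n) \<le> 1"
      using YB[of n] p3 by (simp add: field_simps)
    hence "padic_abs (X (Suc n)) \<ge> real ?p"
      using padic_abs_nonneg[of "Y n - B n"] padic_abs_eq_0[of "Y n - B n"] nz[of n]
      by (simp add: X_Suc padic_abs_divide pos_le_divide_eq less_le)
    moreover have AX: "padic_abs (A (Suc n)) = padic_abs (X (Suc n))"
      unfolding A_eq using padic_abs_browkin_s[OF assms(1)] calculation p3 by simp
    ultimately have ge: "padic_abs (A (Suc n)) \<ge> real ?p" by simp
    hence A0: "A (Suc n) \<noteq> 0" using p3 by auto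
    define v where "v = - padic_val (A (Suc n))"
    have absv: "padic_abs (A (Suc n)) = real ?p powi v"
      using A0 by (simp add: padic_abs_def v_def)
    have "v \<ge> 1"
    proof (rule ccontr)
      assume "\<not> v \<ge> 1"
      hence "real ?p powi v \<le> real ?p powi 0" using p3 by (intro power_int_increasing) auto
      thus False using ge absv p3 by simp
    qed
    moreover have "v \<noteq> 1" using N[of "Suc n"] that by (auto simp: v_def)
    ultimately have "v \<ge> 2" by simp
    hence "real ?p powi 2 \<le> real ?p powi v" using p3 by (intro power_int_increasing) auto
    hence "(real ?p)\<^sup>2 \<le> padic_abs (X (Suc n))" using absv AX by simp
    hence "(real ?p)\<^sup>2 \<le> inverse (padic_abs (Y n - B n))"
      by (simp add: X_Suc padic_abs_divide field_simps)
    hence "inverse (inverse (padic_abs (Y n - B n))) \<le> inverse ((real ?p)\<^sup>2)"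
      using p3 by (intro le_imp_inverse_le) auto
    thus ?thesis by simp
  qed
  have "\<forall>n. \<exists>q. A n = of_rat q \<and> q \<in> ints_inverting ?p \<and> 2 * \<bar>q\<bar> \<le> of_nat ?p"
    using browkin_s_rational[OF assms(1)] unfolding A_eq by blast
  then obtain a where a: "\<And>n. A n = of_rat (a n)" "\<And>n. a n \<in> ints_inverting ?p"
      "\<And>n. 2 * \<bar>a n\<bar> \<le> of_nat ?p" by metis
  have "\<forall>n. \<exists>q. B n = of_rat q \<and> q \<in> ints_inverting ?p \<and> 2 * \<bar>q\<bar> \<le> of_nat ?p"
    using browkin_s_rational[OF assms(1)] unfolding B_eq by blast
  then obtain b where b: "\<And>n. B n = of_rat (b n)" "\<And>n. b n \<in> ints_inverting ?p"
      "\<And>n. 2 * \<bar>b n\<bar> \<le> of_nat ?p" by metis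
  obtain c0 c1 c2 where c: "\<not> (c0 = 0 \<and> c1 = 0 \<and> c2 = 0)"
      "of_rat c0 * 1 + of_rat c1 * \<alpha>1 + of_rat c2 * \<alpha>2 = 0" using assms(2) by blast
  define u where "u = relation_coeff c0 c1 c2 a b"
  have u_init: "u 0 = c0" "u 1 = c2" "u 2 = c1"
    by (simp_all add: u_def numeral_2_eq_2)
  have u_rec: "u (n + 3) = a n * u (n + 2) + b n * u (n + 1) + u n" for n
    by (simp add: u_def numeral_2_eq_2 numeral_3_eq_3)
  have remainder: "of_rat (u (n + 3)) =
      - (of_rat (u (n + 2)) * (X n - A n) + of_rat (u (n + 1)) * (Y n - B n))"
    if "of_rat (u (n + 2)) * X n + of_rat (u (n + 1)) * Y n + of_rat (u n) = 0" for n
  proof -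
    have "of_rat (u (n + 3)) =
        A n * of_rat (u (n + 2)) + B n * of_rat (u (n + 1)) + of_rat (u n)"
      by (simp add: u_rec of_rat_add of_rat_mult a(1) b(1))
    also have "\<dots> = - (of_rat (u (n + 2)) * (X n - A n) + of_rat (u (n + 1)) * (Y n - B n))
        + (of_rat (u (n + 2)) * X n + of_rat (u (n + 1)) * Y n + of_rat (u n))"
      by (simp add: algebra_simps)
    finally show ?thesis using that by simp
  qed
  have rel: "of_rat (u (n + 2)) * X n + of_rat (u (n + 1)) * Y n + of_rat (u n) = 0" for n
  proof (induction n)
    case 0
    have "u (0 + 2) = c1" "u (0 + 1) = c2" by (simp_all only: add_0 add_0_left u_init)
    thus ?case using c(2) by (simp only: u_init X_def Y_def jp_complete_def)
      (simp add: algebra_simps)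
  next
    case (Suc n)
    have "(of_rat (u (n + 3)) * X (Suc n) + of_rat (u (n + 2)) * Y (Suc n) + of_rat (u (n + 1)))
      * (Y n - B n) =
        of_rat (u (n + 3)) + of_rat (u (n + 2)) * (X n - A n) + of_rat (u (n + 1)) * (Y n - B n)"
      using nz[of n] by (simp add: X_Suc Y_Suc distrib_right)
    also have "\<dots> = 0" by (simp add: remainder[OF Suc])
    finally show ?case using nz[of n] by (simp add: numeral_2_eq_2 numeral_3_eq_3)
  qed
  have "rat_padic_abs ?p (u (n + 3)) \<le>
      max (rat_padic_abs ?p (u (n + 2)) / real ?p) (rat_padic_abs ?p (u (n + 1)) / (real ?p)\<^sup>2)"
    if n: "n \<ge> N" for n
  proof -
    have "rat_padic_abs ?p (u (n + 3)) = padic_abs (of_rat (u (n + 3)) :: 'p padic)"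
      by (simp add: padic_abs_of_rat)
    also have "\<dots> \<le> max (rat_padic_abs ?p (u (n + 2)) * padic_abs (X n - A n))
        (rat_padic_abs ?p (u (n + 1)) * padic_abs (Y n - B n))"
      unfolding remainder[OF rel] padic_abs_minus padic_abs_of_rat[symmetric, where 'p='p]
        padic_abs_mult[symmetric] by (rule padic_abs_add)
    also have "\<dots> \<le> max (rat_padic_abs ?p (u (n + 2)) * inverse (real ?p))
        (rat_padic_abs ?p (u (n + 1)) * inverse ((real ?p)\<^sup>2))"
      by (intro max.mono mult_left_mono XA YB2 n) auto
    finally show ?thesis by (simp add: divide_inverse)
  qed
  hence "rat_padic_abs ?p (u (n + 2)) \<le>
      max (rat_padic_abs ?p (u (n + 1)) / real ?p) (rat_padic_abs ?p (u n) / (real ?p)\<^sup>2)"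
    if "n \<ge> N + 1" for n
    using that by (cases n) (auto simp: numeral_2_eq_2 numeral_3_eq_3)
  then obtain M where M: "\<And>n. n \<ge> N + 1 \<Longrightarrow> rat_padic_abs ?p (u n) * real ?p ^ n \<le> M"
    using ultrametric_recurrence_decay[of "real ?p" "N + 1" "\<lambda>n. rat_padic_abs ?p (u n)"] p3 by auto
  have half: "real_of_rat \<bar>q\<bar> \<le> real ?p / 2" if "2 * \<bar>q\<bar> \<le> of_nat ?p" for q :: rat
  proof -
    have "real_of_rat (2 * \<bar>q\<bar>) \<le> real_of_rat (of_nat ?p)" using that by (simp only: of_rat_less_eq)
    thus ?thesis by (simp add: of_rat_mult)
  qed
  have "real_of_rat \<bar>u (n + 3)\<bar> \<le>
      real ?p / 2 * real_of_rat \<bar>u (n + 2)\<bar> + real ?p / 2 * real_of_rat \<bar>u (n + 1)\<bar>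
        + real_of_rat \<bar>u n\<bar>" for n
  proof -
    have "\<bar>u (n + 3)\<bar> \<le> \<bar>a n\<bar> * \<bar>u (n + 2)\<bar> + \<bar>b n\<bar> * \<bar>u (n + 1)\<bar> + \<bar>u n\<bar>"
      unfolding u_rec abs_mult[symmetric] by linarith
    hence "real_of_rat \<bar>u (n + 3)\<bar> \<le>
        real_of_rat (\<bar>a n\<bar> * \<bar>u (n + 2)\<bar> + \<bar>b n\<bar> * \<bar>u (n + 1)\<bar> + \<bar>u n\<bar>)"
      by (simp only: of_rat_less_eq)
    also have "\<dots> = real_of_rat \<bar>a n\<bar> * real_of_rat \<bar>u (n + 2)\<bar> +
        real_of_rat \<bar>b n\<bar> * real_of_rat \<bar>u (n + 1)\<bar> + real_of_rat \<bar>u n\<bar>"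
      by (simp only: of_rat_add of_rat_mult)
    also have "\<dots> \<le> real ?p / 2 * real_of_rat \<bar>u (n + 2)\<bar> +
        real ?p / 2 * real_of_rat \<bar>u (n + 1)\<bar> + real_of_rat \<bar>u n\<bar>"
      by (intro add_mono mult_right_mono half a(3) b(3) order_refl) auto
    finally show ?thesis .
  qed
  then obtain K where K: "\<And>n. real_of_rat \<bar>u n\<bar> \<le> K * (9 / 10 * real ?p) ^ n"
    using recurrence_growth[OF p3, of "\<lambda>n. real_of_rat \<bar>u n\<bar>"] by auto
  obtain D where D: "D > 0" "of_int D * c0 \<in> \<int>" "of_int D * c1 \<in> \<int>" "of_int D * c2 \<in> \<int>"
    using common_denominator[of c0 c1 c2] by blast
  have "of_int D * u n \<in> ints_inverting ?p \<and> of_int D * u (n + 1) \<in> ints_inverting ?p \<and>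
      of_int D * u (n + 2) \<in> ints_inverting ?p" for n
  proof (induction n)
    case 0
    show ?case using D ints_inverting_int u_init by (simp add: numeral_2_eq_2)
  next
    case (Suc n)
    have "of_int D * u (n + 3) =
        a n * (of_int D * u (n + 2)) + b n * (of_int D * u (n + 1)) + of_int D * u n"
      by (simp add: u_rec algebra_simps)
    also have "\<dots> \<in> ints_inverting ?p"
      using Suc.IH by (blast intro: ints_inverting_add ints_inverting_mult[OF a(2)]
          ints_inverting_mult[OF b(2)])
    finally show ?case using Suc by (simp add: numeral_2_eq_2 numeral_3_eq_3)
  qed
  hence D_int: "of_int D * u n \<in> ints_inverting ?p" for n by blast
  have "eventually (\<lambda>n. u n = 0) sequentially"
    by (rule padic_archimedean_eventually_zero[OF p D(1) D_int M K]) auto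
  then obtain n where n: "u n = 0" "u (n + 1) = 0" "u (n + 2) = 0"
    unfolding eventually_sequentially by (meson le_add1 order_refl)
  \<comment> \<open>The coefficient of \<open>u n\<close> in the recurrence is \<open>1\<close>, so zeros propagate backwards.\<close>
  have "u n = 0 \<and> u (n + 1) = 0 \<and> u (n + 2) = 0 \<Longrightarrow> u 0 = 0 \<and> u 1 = 0 \<and> u 2 = 0"
  proof (induction n)
    case (Suc n)
    have later: "u (n + 1) = 0" "u (n + 2) = 0" "u (n + 3) = 0"
      using Suc.prems by (simp_all add: numeral_2_eq_2 numeral_3_eq_3)
    hence "u n = 0" using u_rec[of n] by simp
    thus ?case using Suc.IH later by blast
  qed (simp add: numeral_2_eq_2)
  thus False using n u_init c(1) by simp
qed

end
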